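(* Let $(X,\mathsf d)$ be an extended metric space, let $K\in\mathbb R$, let $F:X\to\mathbb R\cup\{+\infty\}$ be a proper functional (i.e. $D(F)\neq\emptyset$) and let $\mathsf S$ be an $\mathrm{EVI}_K$ gradient flow of $F$ in $X$ relative to $\mathsf d$. Then $\mathsf S$ is an $\mathrm{EVI}_K$ gradient flow of $F$ relative to $\mathsf d_\ell$ and relative to $\bar{\mathsf d}_\ell$.
   Context: An extended metric space $(X,\mathsf d)$ is a set with a symmetric $\mathsf d:X\times X\to[0,\infty]$ satisfying the triangle inequality and $\mathsf d(x,y)=0$ iff $x=y$. $D(F)=\{F<\infty\}$; closures $\overline{D(F)}$ are taken with respect to the distance in use. Absolutely continuous curves: $x\in AC^2([a,b];(X,\mathsf d))$ (resp. $AC$) if there is $g\in L^2(a,b)$ (resp. $L^1(a,b)$) with $\mathsf d(x_s,x_t)\le\int_s^t g(r)\,dr$ for $s\le t$; the metric derivative is $|\dot x|(t)=\limsup_{s\to t}\mathsf d(x_s,x_t)/|s-t|$ (a limit for a.e. $t$). $AC^2_{\rm loc}((0,\infty);\cdot)$ means $AC^2$ on compact subintervals of $(0,\infty)$. $\mathrm{EVI}_K$ gradient curve of $F$ (relative to $\mathsf d$): a curve $x\in AC^2_{\rm loc}((0,\infty);(D(F),\mathsf d))$ such that $t\mapsto F(x_t)$ is lower semicontinuous in $(0,\infty)$ and, for every $y\in D(F)$ with $\mathsf d(y,x_t)<\infty$ for some (hence all) $t>0$, $$\frac{d^+}{dt}\frac12\mathsf d^2(x_t,y)+\frac K2\mathsf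 d^2(x_t,y)\le F(y)-F(x_t)\qquad\forall t>0,$$ where $\frac{d^+}{dt}$ is the upper right derivative. If $\bar x$ has finite distance from $D(F)$, the curve $x$ starts from $\bar x$ if $\liminf_{t\downarrow0}F(x_t)\ge F(\bar x)$ and $\lim_{t\downarrow0}\mathsf d(x_t,y)=\mathsf d(\bar x,y)$ for every $y\in\overline{D(F)}$. $\mathrm{EVI}_K$ gradient flow of $F$ in $D\subset X$: a semigroup $\mathsf S:D\times[0,\infty)\to D$ such that (i) $D\supset\overline{D(F)}$ and every $x\in D$ has finite distance from $D(F)$; (ii) for every $x\in D$ the curve $t\mapsto\mathsf S_tx$ is an $\mathrm{EVI}_K$ gradient curve of $F$ starting from $x$; (iii) $\mathsf d(\mathsf S_tx,\mathsf S_ty)\le e^{-Kt}\mathsf d(x,y)$ for all $x,y\in D$, $t\ge 0$. Length distances: $\mathsf d_\ell(y,z)=\sup_{\varepsilon>0}\mathsf d^\varepsilon(y,z)$ with $\mathsf d^\varepsilon(y,z)=\inf\{\sum_{n=1}^N\mathsf d(x_n,x_{n-1}):\ x_0=y,\ x_N=z,\ \mathsf d(x_{n-1},x_n)\le\varepsilon\}$ (infimum over all finite chains in $X$), and $\bar{\mathsf d}_\ell(y,z)=\inf\{\int_0^1|\dot x|(t)\,dt:\ x\in AC([0,1];(X,\mathsf d)),\ x_0=y,\ x_1=z\}$.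
   Formalization: For each length distance the flow's domain is the closure of D(F) in that distance, not all of X, where points may be infinitely far from D(F); the EVI for every orbit and the contraction are still asserted on all of X, but finite distance and "starts from x" only on that closure. *)

theory Defs
  imports "HOL-Analysis.Analysis"
begin

(* The space X is the whole type 'a; distances take values in [0,\<infinity>]. *)
definition ext_metric :: "('a \<Rightarrow> 'a \<Rightarrow> ennreal) \<Rightarrow> bool" where
  "ext_metric d \<longleftrightarrow>
     (\<forall>x y. d x y = d y x) \<and>
     (\<forall>x y z. d x z \<le> d x y + d y z) \<and>
     (\<forall>x y. d x y = 0 \<longleftrightarrow> x = y)"

definition ext_closure :: "('a \<Rightarrow> 'a \<Rightarrow> ennreal) \<Rightarrow> 'a set \<Rightarrow> 'a set" where
  "ext_closure d A = {x. \<forall>e>0. \<exists>y\<in>A. d x y < e}"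

definition edom :: "('a \<Rightarrow> ereal) \<Rightarrow> 'a set" where
  "edom F = {x. F x < \<infinity>}"

(* AC^p([a,b]; (Y,d)); the competitor g may be signed, hence the comparison in ereal
   (the embedding of the integral into ennreal would truncate negative values). *)
definition AC_curve ::
    "nat \<Rightarrow> ('a \<Rightarrow> 'a \<Rightarrow> ennreal) \<Rightarrow> 'a set \<Rightarrow> real \<Rightarrow> real \<Rightarrow> (real \<Rightarrow> 'a) \<Rightarrow> bool" where
  "AC_curve p d Y a b x \<longleftrightarrow>
     (\<forall>t\<in>{a..b}. x t \<in> Y) \<and>
     (\<exists>g :: real \<Rightarrow> real.
        set_borel_measurable lborel {a..b} g \<and>
        set_integrable lborel {a..b} (\<lambda>r. \<bar>g r\<bar> ^ p) \<and>
        (\<forall>s t. a \<le> s \<and> s \<le> t \<and> t \<le> b \<longrightarrow>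
           enn2ereal (d (x s) (x t)) \<le> ereal (LINT r:{s..t}|lborel. g r)))"

(* I is the interval on which the curve lives; values of x outside I are irrelevant. *)
definition metric_derivative ::
    "('a \<Rightarrow> 'a \<Rightarrow> ennreal) \<Rightarrow> real set \<Rightarrow> (real \<Rightarrow> 'a) \<Rightarrow> real \<Rightarrow> ennreal" where
  "metric_derivative d I x t =
     Limsup (at t within I) (\<lambda>s. d (x s) (x t) / ennreal \<bar>s - t\<bar>)"

definition upper_right_derivative :: "(real \<Rightarrow> real) \<Rightarrow> real \<Rightarrow> ereal" where
  "upper_right_derivative f t = Limsup (at_right 0) (\<lambda>h. ereal ((f (t + h) - f t) / h))"

(* A curve on (0,\<infinity>). In the inequality d (x t) y is finite for all t > 0 as soon as it is
   finite for one t, by absolute continuity, so enn2real loses nothing. *)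
definition EVI_curve ::
    "('a \<Rightarrow> 'a \<Rightarrow> ennreal) \<Rightarrow> real \<Rightarrow> ('a \<Rightarrow> ereal) \<Rightarrow> (real \<Rightarrow> 'a) \<Rightarrow> bool" where
  "EVI_curve d K F x \<longleftrightarrow>
     (\<forall>a b. 0 < a \<and> a \<le> b \<longrightarrow> AC_curve 2 d (edom F) a b x) \<and>
     (\<forall>t>0. F (x t) \<le> Liminf (at t) (\<lambda>s. F (x s))) \<and>
     (\<forall>y\<in>edom F. (\<exists>t>0. d y (x t) < \<infinity>) \<longrightarrow>
        (\<forall>t>0. upper_right_derivative (\<lambda>s. 1/2 * (enn2real (d (x s) y))\<^sup>2) t
                 + ereal (K/2 * (enn2real (d (x t) y))\<^sup>2) \<le> F y - F (x t)))"

definition starts_from ::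
    "('a \<Rightarrow> 'a \<Rightarrow> ennreal) \<Rightarrow> ('a \<Rightarrow> ereal) \<Rightarrow> (real \<Rightarrow> 'a) \<Rightarrow> 'a \<Rightarrow> bool" where
  "starts_from d F x x0 \<longleftrightarrow>
     F x0 \<le> Liminf (at_right 0) (\<lambda>t. F (x t)) \<and>
     (\<forall>y\<in>ext_closure d (edom F). ((\<lambda>t. d (x t) y) \<longlongrightarrow> d x0 y) (at_right 0))"

(* Only the restriction of S to times t \<ge> 0 and points of D matters.
   The domain D depends on the distance: a flow in the whole space relative to d need not
   satisfy the finite-distance clause in the whole space for a larger distance, such as the
   length distances below. *)
definition EVI_flow ::
    "('a \<Rightarrow> 'a \<Rightarrow> ennreal) \<Rightarrow> real \<Rightarrow> ('a \<Rightarrow> ereal) \<Rightarrow> 'a set \<Rightarrow> (real \<Rightarrow> 'a \<Rightarrow> 'a) \<Rightarrow> bool" where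
  "EVI_flow d K F D S \<longleftrightarrow>
     (\<forall>x\<in>D. \<forall>t\<ge>0. S t x \<in> D) \<and>
     (\<forall>x\<in>D. S 0 x = x) \<and>
     (\<forall>x\<in>D. \<forall>s\<ge>0. \<forall>t\<ge>0. S (s + t) x = S s (S t x)) \<and>
     ext_closure d (edom F) \<subseteq> D \<and>
     (\<forall>x\<in>D. \<exists>y\<in>edom F. d x y < \<infinity>) \<and>
     (\<forall>x\<in>D. EVI_curve d K F (\<lambda>t. S t x) \<and> starts_from d F (\<lambda>t. S t x) x) \<and>
     (\<forall>x\<in>D. \<forall>y\<in>D. \<forall>t\<ge>0. d (S t x) (S t y) \<le> ennreal (exp (- K * t)) * d x y)"

definition chain_dist ::
    "('a \<Rightarrow> 'a \<Rightarrow> ennreal) \<Rightarrow> real \<Rightarrow> 'a \<Rightarrow> 'a \<Rightarrow> ennreal" where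
  "chain_dist d e y z =
     Inf {\<Sum>n=1..N. d (x n) (x (n - 1)) | (N :: nat) (x :: nat \<Rightarrow> 'a).
            x 0 = y \<and> x N = z \<and> (\<forall>n\<in>{1..N}. d (x (n - 1)) (x n) \<le> ennreal e)}"

definition length_dist :: "('a \<Rightarrow> 'a \<Rightarrow> ennreal) \<Rightarrow> 'a \<Rightarrow> 'a \<Rightarrow> ennreal" where
  "length_dist d y z = (SUP e\<in>{0<..}. chain_dist d e y z)"

definition AC_length_dist :: "('a \<Rightarrow> 'a \<Rightarrow> ennreal) \<Rightarrow> 'a \<Rightarrow> 'a \<Rightarrow> ennreal" where
  "AC_length_dist d y z =
     Inf {\<integral>\<^sup>+t\<in>{0..1}. metric_derivative d {0..1} x t \<partial>lborel | x :: real \<Rightarrow> 'a.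
            AC_curve 1 d UNIV 0 1 x \<and> x 0 = y \<and> x 1 = z}"

end

theory Submission
  imports Defs
begin

text \<open>
  Take a curve \<open>\<gamma>\<close> on \<open>[0,1]\<close> (or a fine chain) of length \<open>L\<close> from \<open>x\<close> to \<open>y\<close>, parametrised by arc length,
  and run the point \<open>\<gamma>\<^sub>s\<close> for the time \<open>h (1 - s)\<close>. The new curve \<open>z\<close> joins \<open>S\<^sub>h x\<close> to \<open>y\<close>. For \<open>K = 0\<close>,
  contraction and the integrated EVI between neighbouring points give
  \<open>d(z\<^sub>s, z\<^sub>t)\<^sup>2 \<le> (t - s) (L\<^sup>2 (t - s) + 2 h (F z\<^sub>t - F z\<^sub>s))\<close>: the right-hand side is a product of two
  increments, so by the arithmetic-geometric mean inequality \<open>d(z\<^sub>s, z\<^sub>t)\<close> is bounded by an increment of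
  one monotone function and the energies telescope. Hence the length of \<open>z\<close>, squared, is at most
  \<open>L\<^sup>2 + 2 h (F y - F (S\<^sub>h x))\<close>, and dividing by \<open>2 h\<close> yields the EVI for the length distances. For
  general \<open>K\<close> the exponential factors only contribute \<open>- K h L\<^sup>2 + O(h\<^sup>2)\<close>.
\<close>

subsection \<open>Real functions\<close>

text \<open>The two length distances differ only in what counts as a path, so the transfer is done
  once, for an abstract cost relation. The infimum over costs need not be attained: a path of cost
  \<open>c\<close> is available only for \<open>c\<close> above the distance, and this surplus
  disappears together with the parameter \<open>e\<close>. In the flow, \<open>e\<close> measures
  one local error: the integrated EVI over a short time \<open>t\<close> has weights
  \<open>exp (K * t)\<close> and \<open>expint K t\<close>, which agree with 1 and \<open>t\<close>
  only in the limit of fine meshes. The remaining dependence on \<open>K\<close> is kept explicit.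

  The obstacle is regularity. Along the new curve the energy need be neither monotone nor
  continuous; only energy plus a drift is monotone. The resulting control of the distance may jump,
  so continuity of the curve has to come from elsewhere: the product estimate itself gives a
  square-root modulus. The path may leave the domain of \<open>F\<close>. Its points are run for
  positive times and so acquire finite energy, except at the end \<open>s = 1\<close>, where the
  point is \<open>y\<close>.

  Decay of the energy in time is not part of the definition of an EVI curve; it has to be derived
  before the EVI can be integrated with the energy at the final time.\<close>

lemma right_dini_nonincreasing:
  fixes f :: "real \<Rightarrow> real"
  assumes "a \<le> b" and cont: "continuous_on {a..b} f"
    and dini: "\<And>t e. a < t \<Longrightarrow> t < b \<Longrightarrow> 0 < e \<Longrightarrow>
      eventually (\<lambda>h. f (t + h) \<le> f t + e * h) (at_right 0)"
  shows "f b \<le> f a"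
proof (cases "a = b")
  case False
  with \<open>a \<le> b\<close> have "a < b" by simp
  have step: "f b \<le> f s + e * (b - s)" if "0 < e" "a < s" "s < b" for e s
  proof -
    \<comment> \<open>If the last time below the line of slope \<open>e\<close> came before
      \<open>b\<close>, the bound at that time would produce a later one.\<close>
    define Q where "Q = {t\<in>{s..b}. f t \<le> f s + e * (t - s)}"
    have clQ: "closed Q"
    proof -
      have "continuous_on {s..b} (\<lambda>t. f s + e * (t - s) - f t)"
        using that by (intro continuous_intros continuous_on_subset[OF cont]) auto
      then have "closed ({s..b} \<inter> (\<lambda>t. f s + e * (t - s) - f t) -` {0..})"
        by (intro continuous_closed_preimage) auto
      moreover have "Q = {s..b} \<inter> (\<lambda>t. f s + e * (t - s) - f t) -` {0..}"
        by (auto simp: Q_def)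
      ultimately show ?thesis by simp
    qed
    have Q: "s \<in> Q" "bdd_above Q"
      using that by (auto simp: Q_def intro!: bdd_aboveI[of _ b])
    define u where "u = Sup Q"
    have uQ: "u \<in> Q"
      unfolding u_def using Q clQ by (intro closed_contains_Sup) auto
    have "u = b"
    proof (rule ccontr)
      assume "u \<noteq> b"
      with uQ that have u: "a < u" "u < b" "s \<le> u" by (auto simp: Q_def)
      have "eventually (\<lambda>h. f (u + h) \<le> f u + e * h \<and> 0 < h \<and> h < b - u) (at_right 0)"
        using dini[OF u(1,2) \<open>0 < e\<close>] u
        by (intro eventually_conj) (auto simp: eventually_at_right_less intro: eventually_at_rightI[of 0 "b-u"])
      then obtain h where h: "f (u + h) \<le> f u + e * h" "0 < h" "h < b - u"
        using eventually_happens trivial_limit_at_right_real by blast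
      then have "u + h \<in> Q"
        using uQ by (auto simp: Q_def algebra_simps)
      then have "u + h \<le> u"
        unfolding u_def using Q by (intro cSup_upper)
      with h show False by simp
    qed
    with uQ show ?thesis by (simp add: Q_def)
  qed
  have le: "f b \<le> f s" if "a < s" "s < b" for s
  proof (rule field_le_epsilon)
    fix e :: real assume "0 < e"
    with step[of "e / (b - s)" s] that show "f b \<le> f s + e" by simp
  qed
  have "(f \<longlongrightarrow> f a) (at a within {a..b})"
    using cont \<open>a < b\<close> by (auto simp: continuous_on)
  then have "(f \<longlongrightarrow> f a) (at_right a)"
    by (simp add: \<open>a < b\<close> at_within_Icc_at_right)
  moreover have "eventually (\<lambda>s. f b \<le> f s) (at_right a)"
    using le \<open>a < b\<close> by (auto intro: eventually_at_rightI[of a b])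
  ultimately show ?thesis
    using tendsto_lowerbound trivial_limit_at_right_real by blast
qed simp

text \<open>The integral of \<open>exp (K * r)\<close> for \<open>r\<close> from 0 to
  \<open>t\<close>: the weight of a constant source term in Gronwall's inequality.\<close>

definition expint :: "real \<Rightarrow> real \<Rightarrow> real" where
  "expint K t = (if K = 0 then t else (exp (K * t) - 1) / K)"

lemma expint_0 [simp]: "expint K 0 = 0"
  by (simp add: expint_def)

lemma expint_pos: "0 < t \<Longrightarrow> 0 < expint K t"
  by (cases K "0::real" rule: linorder_cases)
     (auto simp: expint_def divide_simps mult_neg_pos)

lemma expint_deriv: "(expint K has_real_derivative exp (K * t)) (at t within A)"
proof (cases "K = 0")
  case True
  then have "expint K = (\<lambda>t. t)" by (auto simp: expint_def)
  with True show ?thesis by simp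
next
  case False
  then have "expint K = (\<lambda>t. (exp (K * t) - 1) / K)" by (auto simp: expint_def)
  with False show ?thesis by (auto intro!: derivative_eq_intros)
qed

lemma tendsto_expint_ratio:
  "((\<lambda>t. exp (K * t) * t / expint K t) \<longlongrightarrow> 1) (at_right 0)"
proof -
  have "((\<lambda>h. (expint K (0 + h) - expint K 0) / h) \<longlongrightarrow> exp (K * 0)) (at 0)"
    using expint_deriv[of K 0 UNIV] unfolding DERIV_def .
  then have "((\<lambda>h. expint K h / h) \<longlongrightarrow> 1) (at_right 0)"
    by (auto intro: tendsto_mono[OF at_le])
  then have "((\<lambda>h. exp (K * h) / (expint K h / h)) \<longlongrightarrow> exp (K * 0) / 1) (at_right 0)"
    by (intro tendsto_intros) auto
  then show ?thesis by simp
qed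

text \<open>The integrating factor turns the bound into monotonicity. To avoid a product rule for
  upper derivatives, \<open>f\<close> is replaced to the right of \<open>t\<close> by a slightly
  steeper line, after which everything is differentiable.\<close>

lemma dini_gronwall:
  fixes f :: "real \<Rightarrow> real"
  assumes "0 \<le> b" and cont: "continuous_on {0..b} f"
    and deriv: "\<And>t. 0 < t \<Longrightarrow> t < b \<Longrightarrow> upper_right_derivative f t \<le> ereal (c - K * f t)"
  shows "exp (K * b) * f b \<le> f 0 + c * expint K b"
proof -
  define g where "g = (\<lambda>t. exp (K * t) * f t - c * expint K t)"
  have "g b \<le> g 0"
  proof (rule right_dini_nonincreasing[OF \<open>0 \<le> b\<close>])
    have "continuous_on {0..b} (expint K)"
      using expint_deriv by (rule DERIV_continuous_on)
    then show "continuous_on {0..b} g"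
      unfolding g_def using cont by (intro continuous_intros)
  next
    fix t e :: real assume t: "0 < t" "t < b" "0 < e"
    \<comment> \<open>Makes the derivative of \<open>q\<close> at 0, which is
      \<open>exp (K * t) * e'\<close>, equal to \<open>e / 2\<close> and so strictly smaller than
      \<open>e\<close>.\<close>
    define e' where "e' = e / (2 * exp (K * t))"
    have "0 < e'" using t by (simp add: e'_def)
    define r where "r = c - K * f t + e'"
    define q where "q = (\<lambda>h. exp (K * (t + h)) * (f t + r * h) - c * expint K (t + h))"
    have "upper_right_derivative f t < ereal r"
      using deriv[OF t(1,2)] \<open>0 < e'\<close> by (auto simp: r_def intro: le_less_trans)
    then have ev1: "eventually (\<lambda>h. (f (t + h) - f t) / h < r) (at_right 0)"
      unfolding upper_right_derivative_def by (auto dest: Limsup_lessD)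
    have "(q has_real_derivative e / 2) (at 0)"
      unfolding q_def using expint_deriv[of K t UNIV]
      by (auto intro!: derivative_eq_intros DERIV_chain2[where f = "expint K"] simp: r_def e'_def field_simps)
    then have "((\<lambda>h. (q (0 + h) - q 0) / h) \<longlongrightarrow> e / 2) (at_right 0)"
      unfolding DERIV_def by (auto intro: tendsto_mono[OF at_le])
    then have ev2: "eventually (\<lambda>h. (q h - q 0) / h < e) (at_right 0)"
      using t by (auto dest: order_tendstoD(2)[of _ _ _ e])
    show "eventually (\<lambda>h. g (t + h) \<le> g t + e * h) (at_right 0)"
      using ev1 ev2 eventually_at_right_less[of 0]
    proof eventually_elim
      case (elim h)
      then have "f (t + h) \<le> f t + r * h" "q h \<le> q 0 + e * h"
        by (auto simp: field_simps)
      then show ?case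
        unfolding g_def q_def
        by (smt (verit, best) add.right_neutral exp_gt_zero mult_left_mono mult_zero_right)
    qed
  qed
  then show ?thesis by (simp add: g_def)
qed

text \<open>A polynomial majorant for the contraction factor; it is what allows \<open>drift\<close>
  to be a polynomial.\<close>

lemma exp_le_quadratic:
  fixes x :: real
  assumes "x \<le> 1"
  shows "exp x \<le> 1 + x + x\<^sup>2"
proof (cases "0 \<le> x")
  case True
  with assms exp_bound[of x] show ?thesis by simp
next
  case False
  define y where "y = - x"
  have y: "0 < y" using False by (simp add: y_def)
  have "1 + y + y\<^sup>2 / 2 \<le> exp y"
    using exp_lower_Taylor_quadratic[of y] y by simp
  \<comment> \<open>For negative arguments a lower bound of \<open>exp y\<close> has to be inverted:
    by this product, \<open>1 - y + y\<^sup>2\<close> is at least the reciprocal of the Taylor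
    polynomial below \<open>exp y\<close>.\<close>
  moreover have "1 \<le> (1 - y + y\<^sup>2) * (1 + y + y\<^sup>2 / 2)"
  proof -
    have "(1 - y + y\<^sup>2) * (1 + y + y\<^sup>2 / 2) = (1 - y + y\<^sup>2) * (2 + 2 * y + y\<^sup>2) / 2"
      by simp
    also have "(1 - y + y\<^sup>2) * (2 + 2 * y + y\<^sup>2) = 2 + y\<^sup>2 + y ^ 3 + y ^ 4"
      by (simp add: algebra_simps power2_eq_square power3_eq_cube power4_eq_xxxx)
    finally have eq: "(1 - y + y\<^sup>2) * (1 + y + y\<^sup>2 / 2) = (2 + y\<^sup>2 + y ^ 3 + y ^ 4) / 2" .
    show ?thesis unfolding eq using y by simp
  qed
  moreover have "0 < 1 - y + y\<^sup>2"
  proof -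
    have "1 - y + y\<^sup>2 = (y - 1/2)\<^sup>2 + 3/4" by (simp add: power2_eq_square algebra_simps)
    then show ?thesis using zero_le_power2[of "y - 1/2"] by linarith
  qed
  ultimately have "1 \<le> (1 - y + y\<^sup>2) * exp y"
    by (smt (verit) mult_left_mono)
  then show ?thesis
    by (simp add: y_def exp_minus field_simps)
qed

text \<open>The estimate for neighbouring points holds only for a short excess time. Monotonicity
  and control of the distance compose over adjacent intervals, so short intervals suffice for
  them.\<close>

lemma local_to_global_on_interval:
  fixes r :: "real \<Rightarrow> real \<Rightarrow> bool"
  assumes "0 < e" and loc: "\<And>s t. a \<le> s \<Longrightarrow> s \<le> t \<Longrightarrow> t \<le> b \<Longrightarrow> t - s \<le> e \<Longrightarrow> r s t"
    and trans: "\<And>s t u. a \<le> s \<Longrightarrow> s \<le> t \<Longrightarrow> t \<le> u \<Longrightarrow> u \<le> b \<Longrightarrow> r s t \<Longrightarrow> r t u \<Longrightarrow> r s u"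
    and st: "a \<le> s" "s \<le> t" "t \<le> b"
  shows "r s t"
proof -
  have *: "r s t" if "a \<le> s" "s \<le> t" "t \<le> b" "t - s \<le> real n * e" for n s t
    using that
  proof (induction n arbitrary: s)
    case 0
    then show ?case using loc[of s t] \<open>0 < e\<close> by auto
  next
    case (Suc n)
    show ?case
    proof (cases "t - s \<le> e")
      case False
      with Suc.prems \<open>0 < e\<close> show ?thesis
        by (intro trans[of s "s + e" t] loc Suc.IH) (auto simp: algebra_simps)
    qed (use Suc.prems loc in auto)
  qed
  obtain n where "(t - s) / e \<le> real n"
    using real_arch_simple by blast
  with \<open>0 < e\<close> show ?thesis
    by (intro *[of s t n] st) (simp add: field_simps)
qed

text \<open>At the exceptional tags, where the derivative bound fails, the Henstock lemma compares the
  integral of \<open>g\<close> over the small interval with the Riemann summand of \<open>g\<close>.\<close>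
lemma increment_le_integral_of_derivative_bound:
  fixes f g m :: "real \<Rightarrow> real"
  assumes "a \<le> b" and g: "g integrable_on {a..b}" and m: "m integrable_on {a..b}"
    and fg: "\<And>u v. a \<le> u \<Longrightarrow> u \<le> v \<Longrightarrow> v \<le> b \<Longrightarrow> f v - f u \<le> integral {u..v} g"
    and fm: "\<And>u. u \<in> {a..b} \<Longrightarrow> m u = g u \<or>
      (\<forall>e>0. \<exists>r>0. \<forall>v\<in>{a..b}. \<bar>v - u\<bar> < r \<longrightarrow> \<bar>f v - f u\<bar> \<le> (m u + e) * \<bar>v - u\<bar>)"
  shows "f b - f a \<le> integral {a..b} m"
proof -
  have main: "f b - f a \<le> integral {a..b} m + (2 * e + e * (b - a))" if "0 < e" for e
  proof -
    obtain G1 where G1: "gauge G1"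
      "\<And>p. p tagged_division_of {a..b} \<Longrightarrow> G1 fine p \<Longrightarrow>
        norm ((\<Sum>(x,k)\<in>p. measure lborel k *\<^sub>R m x) - integral {a..b} m) < e"
      using integrable_integral[OF m, unfolded has_integral_real] \<open>0 < e\<close> by meson
    obtain G2 where G2: "gauge G2"
      "\<And>p. p tagged_partial_division_of {a..b} \<Longrightarrow> G2 fine p \<Longrightarrow>
        (\<Sum>(x,k)\<in>p. norm (measure lborel k *\<^sub>R g x - integral k g)) < e"
      using Henstock_lemma[of g a b e] g \<open>0 < e\<close> by (auto simp: cbox_interval)
    have "\<exists>r>0. u \<in> {a..b} \<longrightarrow> m u = g u \<or>
        (\<forall>v\<in>{a..b}. \<bar>v - u\<bar> < r \<longrightarrow> \<bar>f v - f u\<bar> \<le> (m u + e) * \<bar>v - u\<bar>)" for u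
    proof (cases "u \<in> {a..b} \<and> m u \<noteq> g u")
      case True
      then show ?thesis using fm[of u] \<open>0 < e\<close> by blast
    next
      case False
      then show ?thesis by (intro exI[of _ 1]) auto
    qed
    then obtain r where r: "\<And>u. 0 < r u"
      "\<And>u v. u \<in> {a..b} \<Longrightarrow> m u \<noteq> g u \<Longrightarrow> v \<in> {a..b} \<Longrightarrow> \<bar>v - u\<bar> < r u \<Longrightarrow>
         \<bar>f v - f u\<bar> \<le> (m u + e) * \<bar>v - u\<bar>"
      by metis
    define G3 where "G3 = (\<lambda>u. ball u (r u))"
    have "gauge (\<lambda>u. G1 u \<inter> (G2 u \<inter> G3 u))"
      unfolding G3_def using G1(1) G2(1) r(1) by (intro gauge_Int gauge_ball_dependent allI)
    then obtain p where p: "p tagged_division_of {a..b}" "(\<lambda>u. G1 u \<inter> (G2 u \<inter> G3 u)) fine p"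
      using fine_division_exists_real by blast
    then have fine: "G1 fine p" "G2 fine p" "G3 fine p"
      by (auto simp: fine_Int)
    have term_le: "f (Sup k) - f (Inf k) \<le>
        measure lborel k *\<^sub>R m u + norm (measure lborel k *\<^sub>R g u - integral k g) + e * (Sup k - Inf k)"
      if uk: "(u, k) \<in> p" for u k
    proof -
      obtain s t where k: "k = {s..t}" and sub: "k \<subseteq> {a..b}" and uk': "u \<in> k"
        using tagged_division_ofD(2,3,4)[OF p(1) uk] by (metis box_real(2))
      then have st: "a \<le> s" "s \<le> u" "u \<le> t" "t \<le> b" by auto
      then have [simp]: "Inf k = s" "Sup k = t" "measure lborel k = t - s" by (auto simp: k)
      show ?thesis
      proof (cases "m u = g u")
        case True
        have "f t - f s \<le> integral k g"
          using fg[of s t] st by (simp add: k)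
        also have "\<dots> \<le> measure lborel k *\<^sub>R g u + norm (measure lborel k *\<^sub>R g u - integral k g)"
          by simp
        finally show ?thesis
          using True \<open>0 < e\<close> st
          by simp (smt (verit) mult_nonneg_nonneg)
      next
        case False
        \<comment> \<open>The derivative bound compares only with the value at the tag. The tag lies
          in its interval, so the bound is used once on each side of it and the two pieces are
          added.\<close>
        have "k \<subseteq> ball u (r u)"
          using fineD[OF fine(3) uk] by (simp add: G3_def)
        moreover have "s \<in> k" "t \<in> k" using st by (auto simp: k)
        ultimately have "\<bar>s - u\<bar> < r u" "\<bar>t - u\<bar> < r u"
          by (auto simp: dist_real_def)
        then have "\<bar>f s - f u\<bar> \<le> (m u + e) * \<bar>s - u\<bar>" "\<bar>f t - f u\<bar> \<le> (m u + e) * \<bar>t - u\<bar>"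
          using st False r(2)[of u s] r(2)[of u t] by simp_all
        then have "f t - f s \<le> (m u + e) * (t - s)"
          using st by (simp add: algebra_simps)
        then show ?thesis by (simp add: algebra_simps)
      qed
    qed
    have "f b - f a = (\<Sum>(u,k)\<in>p. f (Sup k) - f (Inf k))"
      by (simp add: additive_tagged_division_1[OF \<open>a \<le> b\<close> p(1)])
    also have "\<dots> \<le> (\<Sum>(u,k)\<in>p. measure lborel k *\<^sub>R m u + norm (measure lborel k *\<^sub>R g u - integral k g)
        + e * (Sup k - Inf k))"
      by (rule sum_mono) (use term_le in auto)
    also have "\<dots> = (\<Sum>(u,k)\<in>p. measure lborel k *\<^sub>R m u)
        + (\<Sum>(u,k)\<in>p. norm (measure lborel k *\<^sub>R g u - integral k g)) + e * (\<Sum>(u,k)\<in>p. Sup k - Inf k)"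
      by (simp add: split_def sum.distrib sum_distrib_left)
    also have "(\<Sum>(u,k)\<in>p. Sup k - Inf k) = b - a"
      using additive_tagged_division_1[OF \<open>a \<le> b\<close> p(1), of "\<lambda>x. x"] .
    also have "(\<Sum>(u,k)\<in>p. measure lborel k *\<^sub>R m u) \<le> integral {a..b} m + e"
      using G1(2)[OF p(1) fine(1)] by (simp add: abs_if split: if_splits)
    also have "(\<Sum>(u,k)\<in>p. norm (measure lborel k *\<^sub>R g u - integral k g)) \<le> e"
      using G2(2)[OF _ fine(2)] p(1) by (auto simp: tagged_division_of_def)
    finally show ?thesis by simp
  qed
  show ?thesis
  proof (rule field_le_epsilon)
    fix e :: real assume "0 < e"
    define e' where "e' = e / (2 + (b - a))"
    have "0 < e'" using \<open>0 < e\<close> \<open>a \<le> b\<close> by (simp add: e'_def)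
    have "2 * e' + e' * (b - a) = e' * (2 + (b - a))" by (simp add: algebra_simps)
    also have "\<dots> = e" using \<open>a \<le> b\<close> by (simp add: e'_def)
    finally show "f b - f a \<le> integral {a..b} m + e"
      using main[OF \<open>0 < e'\<close>] by simp
  qed
qed

subsection \<open>Arcs\<close>

lemma ext_metricD:
  assumes "ext_metric d"
  shows ext_metric_sym: "d x y = d y x"
    and ext_metric_triangle: "d x z \<le> d x y + d y z"
    and ext_metric_zero_iff: "d x y = 0 \<longleftrightarrow> x = y"
  using assms unfolding ext_metric_def by blast+

lemma ext_metric_refl: "ext_metric d \<Longrightarrow> d x x = 0"
  by (simp add: ext_metric_zero_iff)

text \<open>The curve is only required to be 1-Lipschitz, so it may rest. Thus \<open>c\<close> is
  any upper bound for the length, and concatenation and Lipschitz images need no measure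
  theory.\<close>

definition unit_arc :: "('a \<Rightarrow> 'a \<Rightarrow> ennreal) \<Rightarrow> real \<Rightarrow> 'a \<Rightarrow> 'a \<Rightarrow> bool" where
  "unit_arc d c y z \<longleftrightarrow> 0 \<le> c \<and> (\<exists>\<gamma>. \<gamma> 0 = y \<and> \<gamma> c = z \<and>
     (\<forall>s t. 0 \<le> s \<and> s \<le> t \<and> t \<le> c \<longrightarrow> d (\<gamma> s) (\<gamma> t) \<le> ennreal (t - s)))"

lemma unit_arc_sym:
  assumes "ext_metric d" "unit_arc d c y z"
  shows "unit_arc d c z y"
proof -
  obtain \<gamma> where c: "0 \<le> c" and \<gamma>: "\<gamma> 0 = y" "\<gamma> c = z"
    "\<And>s t. 0 \<le> s \<Longrightarrow> s \<le> t \<Longrightarrow> t \<le> c \<Longrightarrow> d (\<gamma> s) (\<gamma> t) \<le> ennreal (t - s)"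
    using assms(2) unfolding unit_arc_def by blast
  show ?thesis
    unfolding unit_arc_def
  proof (intro conjI c exI[of _ "\<lambda>s. \<gamma> (c - s)"] allI impI)
    fix s t assume "0 \<le> s \<and> s \<le> t \<and> t \<le> c"
    then show "d (\<gamma> (c - s)) (\<gamma> (c - t)) \<le> ennreal (t - s)"
      using \<gamma>(3)[of "c - t" "c - s"] by (simp add: ext_metric_sym[OF assms(1)])
  qed (use \<gamma>(1,2) in auto)
qed

lemma unit_arc_trans:
  assumes d: "ext_metric d" and "unit_arc d c1 x y" "unit_arc d c2 y z"
  shows "unit_arc d (c1 + c2) x z"
proof -
  obtain \<gamma>1 where c1: "0 \<le> c1" and \<gamma>1: "\<gamma>1 0 = x" "\<gamma>1 c1 = y"
    "\<And>s t. 0 \<le> s \<Longrightarrow> s \<le> t \<Longrightarrow> t \<le> c1 \<Longrightarrow> d (\<gamma>1 s) (\<gamma>1 t) \<le> ennreal (t - s)"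
    using assms(2) unfolding unit_arc_def by blast
  obtain \<gamma>2 where c2: "0 \<le> c2" and \<gamma>2: "\<gamma>2 0 = y" "\<gamma>2 c2 = z"
    "\<And>s t. 0 \<le> s \<Longrightarrow> s \<le> t \<Longrightarrow> t \<le> c2 \<Longrightarrow> d (\<gamma>2 s) (\<gamma>2 t) \<le> ennreal (t - s)"
    using assms(3) unfolding unit_arc_def by blast
  define \<gamma> where "\<gamma> = (\<lambda>s. if s \<le> c1 then \<gamma>1 s else \<gamma>2 (s - c1))"
  have "\<gamma> (c1 + c2) = z"
    using c2 \<gamma>1(2) \<gamma>2(1,2) by (cases "c2 = 0") (auto simp: \<gamma>_def)
  moreover have "\<gamma> 0 = x" using c1 \<gamma>1(1) by (simp add: \<gamma>_def)
  moreover have "d (\<gamma> s) (\<gamma> t) \<le> ennreal (t - s)"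
    if st: "0 \<le> s \<and> s \<le> t \<and> t \<le> c1 + c2" for s t
  proof -
    consider "t \<le> c1" | "s \<le> c1" "c1 < t" | "c1 < s" using st by linarith
    then show ?thesis
    proof cases
      case 1
      then show ?thesis using st \<gamma>1(3)[of s t] by (simp add: \<gamma>_def)
    next
      case 2
      have "d (\<gamma>1 s) (\<gamma>2 (t - c1)) \<le> d (\<gamma>1 s) y + d y (\<gamma>2 (t - c1))"
        by (rule ext_metric_triangle[OF d])
      also have "\<dots> \<le> ennreal (c1 - s) + ennreal (t - c1)"
        using st 2 \<gamma>1(3)[of s c1] \<gamma>2(3)[of 0 "t - c1"] \<gamma>1(2) \<gamma>2(1) by (intro add_mono) auto
      also have "\<dots> = ennreal (t - s)"
        using 2 st by (simp flip: ennreal_plus)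
      finally show ?thesis using 2 by (simp add: \<gamma>_def)
    next
      case 3
      then show ?thesis using st \<gamma>2(3)[of "s - c1" "t - c1"] by (simp add: \<gamma>_def)
    qed
  qed
  ultimately show ?thesis
    unfolding unit_arc_def using add_nonneg_nonneg[OF c1 c2] by blast
qed

text \<open>The reparametrisation inverts \<open>R\<close>, which may jump; at a jump the new curve rests, and
  continuity of \<open>z\<close> makes up for the one-sided limits of \<open>R\<close>.\<close>
lemma unit_arc_of_control:
  fixes a b c :: real and R :: "real \<Rightarrow> real"
  assumes d: "ext_metric d" and "a \<le> b"
    and R: "\<And>s t. a \<le> s \<Longrightarrow> s \<le> t \<Longrightarrow> t \<le> b \<Longrightarrow> R s \<le> R t"
    and dR: "\<And>s t. a \<le> s \<Longrightarrow> s \<le> t \<Longrightarrow> t \<le> b \<Longrightarrow> d (z s) (z t) \<le> ennreal (R t - R s)"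
    and cont: "\<And>t e. t \<in> {a..b} \<Longrightarrow> 0 < e \<Longrightarrow>
      \<exists>r>0. \<forall>s\<in>{a..b}. \<bar>s - t\<bar> < r \<longrightarrow> d (z s) (z t) \<le> ennreal e"
    and c: "R b - R a \<le> c"
  shows "unit_arc d c (z a) (z b)"
proof -
  \<comment> \<open>\<open>\<rho> \<sigma>\<close> is the generalised inverse of
    \<open>R - R a\<close>: the supremum of the times at which at most \<sigma> has been spent. The
    supremum need not lie in \<open>T \<sigma>\<close>, hence \<open>below\<close> and
    \<open>above\<close> compare with strictly earlier and strictly later times.\<close>
  define T where "T = (\<lambda>\<sigma>. {t\<in>{a..b}. R t - R a \<le> \<sigma>})"
  define \<rho> where "\<rho> = (\<lambda>\<sigma>. Sup (T \<sigma>))"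
  have aT: "a \<in> T \<sigma>" if "0 \<le> \<sigma>" for \<sigma>
    using that \<open>a \<le> b\<close> by (simp add: T_def)
  have bdd: "bdd_above (T \<sigma>)" for \<sigma>
    by (auto simp: T_def intro!: bdd_aboveI[of _ b])
  have \<rho>_in: "\<rho> \<sigma> \<in> {a..b}" if "0 \<le> \<sigma>" for \<sigma>
    unfolding \<rho>_def using aT[OF that] bdd
    by (auto simp: T_def intro!: cSup_upper cSup_least)
  have below: "R q - R a \<le> \<sigma>" if h: "0 \<le> \<sigma>" "a \<le> q" "q < \<rho> \<sigma>" for q \<sigma>
  proof -
    obtain t where "t \<in> T \<sigma>" "q < t"
      using h less_cSup_iff[OF _ bdd, of \<sigma> q] aT[of \<sigma>] by (auto simp: \<rho>_def)
    then show ?thesis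
      using R[of q t] that by (auto simp: T_def)
  qed
  have above: "\<sigma> < R p - R a" if "\<rho> \<sigma> < p" "p \<le> b" "a \<le> p" for p \<sigma>
  proof (rule ccontr)
    assume "\<not> \<sigma> < R p - R a"
    then have "p \<in> T \<sigma>" using that by (simp add: T_def)
    then have "p \<le> \<rho> \<sigma>" unfolding \<rho>_def using bdd by (intro cSup_upper)
    with that show False by simp
  qed
  have near_left: "\<exists>q. t0 < q \<and> q < t \<and> d (z q) (z t) \<le> ennreal e"
    if h: "a \<le> t0" "t0 < t" "t \<le> b" "0 < e" for t t0 e
  proof -
    obtain r where "0 < r" and r: "\<And>s. s\<in>{a..b} \<Longrightarrow> \<bar>s - t\<bar> < r \<Longrightarrow> d (z s) (z t) \<le> ennreal e"
      using cont[of t e] h by auto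
    define q where "q = max ((t0 + t) / 2) (t - r / 2)"
    have "t0 < q" "q < t" "\<bar>q - t\<bar> < r"
      using that \<open>0 < r\<close> by (auto simp: q_def max_def field_simps abs_if)
    with that show ?thesis by (intro exI[of _ q] conjI r) auto
  qed
  have near_right: "\<exists>q. t < q \<and> q < t0 \<and> d (z q) (z t) \<le> ennreal e"
    if h: "a \<le> t" "t < t0" "t0 \<le> b" "0 < e" for t t0 e
  proof -
    obtain r where "0 < r" and r: "\<And>s. s\<in>{a..b} \<Longrightarrow> \<bar>s - t\<bar> < r \<Longrightarrow> d (z s) (z t) \<le> ennreal e"
      using cont[of t e] h by auto
    define q where "q = min ((t0 + t) / 2) (t + r / 2)"
    have "q < t0" "t < q" "\<bar>q - t\<bar> < r"
      using that \<open>0 < r\<close> by (auto simp: q_def min_def field_simps abs_if)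
    with that show ?thesis by (intro exI[of _ q] conjI r) auto
  qed
  have lip: "d (z (\<rho> s)) (z (\<rho> t)) \<le> ennreal (t - s)" if st: "0 \<le> s" "s \<le> t" for s t
  proof (cases "\<rho> s < \<rho> t")
    case True
    show ?thesis
    proof (rule ennreal_le_epsilon)
      fix e :: real assume "0 < e"
      \<comment> \<open>Between a time just after \<open>\<rho> s\<close> and a time just before
        \<open>\<rho> t\<close> the control grows by at most \<open>t - s\<close>. Continuity of
        \<open>z\<close> pays for the two short ends, where \<open>R\<close> may jump.\<close>
      obtain p where p: "\<rho> s < p" "p < \<rho> t" "d (z p) (z (\<rho> s)) \<le> ennreal (e / 2)"
        using near_right[of "\<rho> s" "\<rho> t" "e / 2"] True \<rho>_in[of s] \<rho>_in[of t] st \<open>0 < e\<close> by auto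
      obtain q where q: "p < q" "q < \<rho> t" "d (z q) (z (\<rho> t)) \<le> ennreal (e / 2)"
        using near_left[of p "\<rho> t" "e / 2"] p \<rho>_in[of s] \<rho>_in[of t] st \<open>0 < e\<close> by auto
      have "R q - R p \<le> t - s"
        using above[of s p] below[of t q] p q st \<rho>_in[of s] \<rho>_in[of t] by auto
      then have pq: "d (z p) (z q) \<le> ennreal (t - s)"
        using dR[of p q] p q st \<rho>_in[of s] \<rho>_in[of t]
        by (auto intro: order_trans ennreal_leI)
      have "d (z (\<rho> s)) (z (\<rho> t)) \<le> d (z (\<rho> s)) (z p) + (d (z p) (z q) + d (z q) (z (\<rho> t)))"
        by (meson add_left_mono d ext_metric_triangle order_trans)
      also have "\<dots> \<le> ennreal (e / 2) + (ennreal (t - s) + ennreal (e / 2))"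
        using p q pq by (intro add_mono) (auto simp: ext_metric_sym[OF d])
      also have "\<dots> = ennreal (t - s) + ennreal e"
        using \<open>0 < e\<close> st by (simp flip: ennreal_plus)
      finally show "d (z (\<rho> s)) (z (\<rho> t)) \<le> ennreal (t - s) + ennreal e" .
    qed
  next
    case False
    have "T s \<subseteq> T t" using st by (auto simp: T_def)
    then have "\<rho> s \<le> \<rho> t"
      unfolding \<rho>_def using aT[OF st(1)] bdd by (intro cSup_subset_mono) auto
    with False show ?thesis by (simp add: ext_metric_refl[OF d])
  qed
  \<comment> \<open>If \<open>R\<close> is flat at the beginning, \<open>\<rho> 0\<close> lies
    beyond \<open>a\<close>; the control then forces \<open>z\<close> to rest in between, so the arc
    still starts at \<open>z a\<close>.\<close>
  have "d (z a) (z (\<rho> 0)) = 0"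
  proof (cases "a < \<rho> 0")
    case True
    have "d (z a) (z (\<rho> 0)) \<le> 0"
    proof (rule ennreal_le_epsilon)
      fix e :: real assume "0 < e"
      obtain q where q: "a < q" "q < \<rho> 0" "d (z q) (z (\<rho> 0)) \<le> ennreal e"
        using near_left[of a "\<rho> 0" e] True \<rho>_in[of 0] \<open>0 < e\<close> by auto
      have "R q - R a \<le> 0"
        using below[of 0 q] q by simp
      then have "d (z a) (z q) \<le> 0"
        using dR[of a q] q \<rho>_in[of 0] by (simp add: ennreal_neg)
      then show "d (z a) (z (\<rho> 0)) \<le> 0 + ennreal e"
        using ext_metric_triangle[OF d, of "z a" "z (\<rho> 0)" "z q"] q
        by (metis add.commute add_0 le_zero_eq order_trans)
    qed
    then show ?thesis by simp
  next
    case False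
    then show ?thesis using \<rho>_in[of 0] by (simp add: ext_metric_refl[OF d])
  qed
  then have start: "z (\<rho> 0) = z a" by (simp add: ext_metric_zero_iff[OF d])
  have "0 \<le> c" using c R[of a b] \<open>a \<le> b\<close> by simp
  have "\<rho> c = b"
  proof -
    have "b \<in> T c" using c \<open>a \<le> b\<close> by (simp add: T_def)
    then have "b \<le> \<rho> c" unfolding \<rho>_def using bdd by (intro cSup_upper)
    with \<rho>_in[OF \<open>0 \<le> c\<close>] show ?thesis by simp
  qed
  with start lip \<open>0 \<le> c\<close> show ?thesis
    unfolding unit_arc_def by (intro conjI exI[of _ "\<lambda>s. z (\<rho> s)"]) auto
qed

lemma unit_arc_lipschitz_image:
  assumes d: "ext_metric d" and "0 \<le> l" and f: "\<And>x y. d (f x) (f y) \<le> ennreal l * d x y"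
    and "unit_arc d c y z"
  shows "unit_arc d (l * c) (f y) (f z)"
proof -
  obtain \<gamma> where c: "0 \<le> c" and \<gamma>: "\<gamma> 0 = y" "\<gamma> c = z"
    "\<And>s t. 0 \<le> s \<Longrightarrow> s \<le> t \<Longrightarrow> t \<le> c \<Longrightarrow> d (\<gamma> s) (\<gamma> t) \<le> ennreal (t - s)"
    using assms(4) unfolding unit_arc_def by blast
  have lip: "d (f (\<gamma> s)) (f (\<gamma> t)) \<le> ennreal (l * t - l * s)" if "0 \<le> s" "s \<le> t" "t \<le> c" for s t
  proof -
    have "d (f (\<gamma> s)) (f (\<gamma> t)) \<le> ennreal l * ennreal (t - s)"
      using f \<gamma>(3)[OF that] by (meson mult_left_mono order_trans zero_le)
    also have "\<dots> = ennreal (l * t - l * s)"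
      using \<open>0 \<le> l\<close> that by (simp add: right_diff_distrib flip: ennreal_mult)
    finally show ?thesis .
  qed
  have "unit_arc d (l * c) (f (\<gamma> 0)) (f (\<gamma> c))"
  proof (rule unit_arc_of_control[OF d c, where R = "\<lambda>s. l * s" and z = "\<lambda>s. f (\<gamma> s)"])
    fix t e :: real assume t: "t \<in> {0..c}" and "0 < e"
    have "d (f (\<gamma> s)) (f (\<gamma> t)) \<le> ennreal e"
      if "s \<in> {0..c}" "\<bar>s - t\<bar> < e / (l + 1)" for s
    proof -
      have "d (f (\<gamma> s)) (f (\<gamma> t)) \<le> ennreal (l * \<bar>s - t\<bar>)"
        using lip[of s t] lip[of t s] that(1) t
        by (cases "s \<le> t") (auto simp: abs_if right_diff_distrib ext_metric_sym[OF d])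
      also have "l * \<bar>s - t\<bar> \<le> (l + 1) * \<bar>s - t\<bar>" by (simp add: mult_right_mono)
      also have "\<dots> \<le> e" using that(2) \<open>0 \<le> l\<close> by (simp add: field_simps)
      finally show ?thesis by (simp add: ennreal_leI)
    qed
    then show "\<exists>r>0. \<forall>s\<in>{0..c}. \<bar>s - t\<bar> < r \<longrightarrow> d (f (\<gamma> s)) (f (\<gamma> t)) \<le> ennreal e"
      using \<open>0 < e\<close> \<open>0 \<le> l\<close> by (intro exI[of _ "e / (l + 1)"]) auto
  qed (use lip \<open>0 \<le> l\<close> in \<open>auto intro: mult_left_mono\<close>)
  with \<gamma> show ?thesis by simp
qed

subsection \<open>Absolutely continuous curves\<close>

text \<open>A signed competitor may be replaced by its absolute value. On a bounded interval
  \<open>\<bar>g r\<bar> \<le> 1 + \<bar>g r\<bar> ^ p\<close> makes it integrable, so that its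
  Lebesgue and gauge integrals agree.\<close>

lemma AC_curve_control:
  assumes "AC_curve p d Y a b x" "1 \<le> p"
  obtains g where "\<And>t. 0 \<le> g t" "set_borel_measurable lborel {a..b} g"
    "set_integrable lborel {a..b} (\<lambda>r. \<bar>g r\<bar> ^ p)" "set_integrable lborel {a..b} g"
    "\<And>s t. a \<le> s \<Longrightarrow> s \<le> t \<Longrightarrow> t \<le> b \<Longrightarrow> d (x s) (x t) \<le> ennreal (integral {s..t} g)"
    "\<And>s t. a \<le> s \<Longrightarrow> s \<le> t \<Longrightarrow> t \<le> b \<Longrightarrow> (LINT r:{s..t}|lborel. g r) = integral {s..t} g"
proof -
  obtain g where g: "set_borel_measurable lborel {a..b} g"
    "set_integrable lborel {a..b} (\<lambda>r. \<bar>g r\<bar> ^ p)"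
    "\<And>s t. a \<le> s \<Longrightarrow> s \<le> t \<Longrightarrow> t \<le> b \<Longrightarrow>
       enn2ereal (d (x s) (x t)) \<le> ereal (LINT r:{s..t}|lborel. g r)"
    using assms(1) unfolding AC_curve_def by blast
  have bnd: "norm (g r) \<le> norm (1 + \<bar>g r\<bar> ^ p)" for r
  proof (cases "\<bar>g r\<bar> \<le> 1")
    case False
    then have "\<bar>g r\<bar> ^ 1 \<le> \<bar>g r\<bar> ^ p" using \<open>1 \<le> p\<close> by (intro power_increasing) auto
    then show ?thesis by simp
  qed (simp add: add_increasing2)
  have "set_integrable lborel {a..b} (\<lambda>r. 1 + \<bar>g r\<bar> ^ p)"
    using g(2) by (intro set_integral_add) (auto intro!: borel_integrable_atLeastAtMost')
  then have gi: "set_integrable lborel {a..b} g"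
    by (rule set_integrable_bound[OF _ g(1)]) (intro AE_I2 impI bnd)
  then have ai: "set_integrable lborel {a..b} (\<lambda>r. \<bar>g r\<bar>)"
    by (rule set_integrable_abs)
  have sub: "set_integrable lborel {s..t} g" "set_integrable lborel {s..t} (\<lambda>r. \<bar>g r\<bar>)"
    if "a \<le> s" "t \<le> b" for s t
    using that by (auto intro!: set_integrable_subset[OF gi] set_integrable_subset[OF ai])
  show thesis
  proof (rule that[of "\<lambda>r. \<bar>g r\<bar>"])
    show "set_borel_measurable lborel {a..b} (\<lambda>r. \<bar>g r\<bar>)"
      using ai by (auto simp: set_integrable_def set_borel_measurable_def)
    fix s t assume st: "a \<le> s" "s \<le> t" "t \<le> b"
    show "(LINT r:{s..t}|lborel. \<bar>g r\<bar>) = integral {s..t} (\<lambda>r. \<bar>g r\<bar>)"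
      using set_borel_integral_eq_integral(2)[OF sub(2)] st by simp
    then have "enn2ereal (d (x s) (x t)) \<le> ereal (integral {s..t} (\<lambda>r. \<bar>g r\<bar>))"
      using g(3)[OF st] set_integral_mono[OF sub(1)[OF st(1,3)] sub(2)[OF st(1,3)]]
      by (simp add: order_trans)
    moreover have "0 \<le> integral {s..t} (\<lambda>r. \<bar>g r\<bar>)"
      by (rule Henstock_Kurzweil_Integration.integral_nonneg)
         (use set_borel_integral_eq_integral(1)[OF sub(2)] st in auto)
    ultimately show "d (x s) (x t) \<le> ennreal (integral {s..t} (\<lambda>r. \<bar>g r\<bar>))"
      by (metis e2ennreal_ereal e2ennreal_mono e2ennreal_enn2ereal)
  qed (use g ai in auto)
qed

lemma integral_control_continuous:
  fixes g :: "real \<Rightarrow> real"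
  assumes d: "ext_metric d" and g: "g integrable_on {a..b}"
    and dg: "\<And>s t. a \<le> s \<Longrightarrow> s \<le> t \<Longrightarrow> t \<le> b \<Longrightarrow> d (x s) (x t) \<le> ennreal (integral {s..t} g)"
    and t: "t \<in> {a..b}" and "0 < e"
  shows "\<exists>r>0. \<forall>s\<in>{a..b}. \<bar>s - t\<bar> < r \<longrightarrow> d (x s) (x t) \<le> ennreal e"
proof -
  have "continuous_on {a..b} (\<lambda>s. integral {a..s} g)"
    using g by (rule indefinite_integral_continuous_1)
  then obtain r where "0 < r" and
    r: "\<And>s. s \<in> {a..b} \<Longrightarrow> \<bar>s - t\<bar> < r \<Longrightarrow> \<bar>integral {a..s} g - integral {a..t} g\<bar> < e"
    using t \<open>0 < e\<close> unfolding continuous_on_iff dist_real_def by metis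
  have "d (x s) (x t) \<le> ennreal e" if s: "s \<in> {a..b}" "\<bar>s - t\<bar> < r" for s
  proof -
    have split: "integral {a..u} g + integral {u..v} g = integral {a..v} g"
      if "a \<le> u" "u \<le> v" "v \<le> b" for u v
      using that by (intro Henstock_Kurzweil_Integration.integral_combine
          integrable_on_subinterval[OF g]) auto
    consider "s \<le> t" | "t \<le> s" by linarith
    then show ?thesis
    proof cases
      case 1
      then have "integral {s..t} g \<le> e" using split[of s t] r[OF s] s t by simp
      then show ?thesis using dg[of s t] 1 s t by (auto intro: order_trans ennreal_leI)
    next
      case 2
      then have "integral {t..s} g \<le> e" using split[of t s] r[OF s] s t by simp
      then show ?thesis using dg[of t s] 2 s t ext_metric_sym[OF d, of "x s" "x t"]
        by (auto intro: order_trans ennreal_leI)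
    qed
  qed
  with \<open>0 < r\<close> show ?thesis by blast
qed

lemma unit_arc_of_integral_control:
  fixes g :: "real \<Rightarrow> real"
  assumes d: "ext_metric d" and g: "g integrable_on {a..b}" "\<And>r. 0 \<le> g r"
    and dg: "\<And>s t. a \<le> s \<Longrightarrow> s \<le> t \<Longrightarrow> t \<le> b \<Longrightarrow> d (x s) (x t) \<le> ennreal (integral {s..t} g)"
    and "a \<le> b" "integral {a..b} g \<le> c"
  shows "unit_arc d c (x a) (x b)"
proof (rule unit_arc_of_control[OF d \<open>a \<le> b\<close>, where R = "\<lambda>t. integral {a..t} g"])
  have split: "integral {a..u} g + integral {u..v} g = integral {a..v} g"
    if "a \<le> u" "u \<le> v" "v \<le> b" for u v
    using that by (intro Henstock_Kurzweil_Integration.integral_combine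
        integrable_on_subinterval[OF g(1)]) auto
  fix s t assume st: "a \<le> s" "s \<le> t" "t \<le> b"
  have "0 \<le> integral {s..t} g"
    using st g by (intro Henstock_Kurzweil_Integration.integral_nonneg
        integrable_on_subinterval[OF g(1)]) auto
  with split[OF st] show "integral {a..s} g \<le> integral {a..t} g" by simp
  show "d (x s) (x t) \<le> ennreal (integral {a..t} g - integral {a..s} g)"
    using split[OF st] dg[OF st] by (metis add_diff_cancel_left')
next
  show "integral {a..b} g - integral {a..a} g \<le> c" using assms by simp
qed (rule integral_control_continuous[OF d g(1) dg])

text \<open>Each piece of the curve is itself an arc whose cost is the integral of \<open>g\<close>.
  Hence the same \<open>g\<close> serves for every distance that is bounded by the cost of
  arcs.\<close>

lemma AC_curve_transfer:
  assumes d: "ext_metric d" and AC: "AC_curve p d Y a b x" "1 \<le> p"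
    and d': "\<And>c y z. unit_arc d c y z \<Longrightarrow> d' y z \<le> ennreal c"
  shows "AC_curve p d' Y a b x"
proof -
  obtain g where g: "\<And>t. 0 \<le> g t" "set_borel_measurable lborel {a..b} g"
    "set_integrable lborel {a..b} (\<lambda>r. \<bar>g r\<bar> ^ p)" "set_integrable lborel {a..b} g"
    "\<And>s t. a \<le> s \<Longrightarrow> s \<le> t \<Longrightarrow> t \<le> b \<Longrightarrow> d (x s) (x t) \<le> ennreal (integral {s..t} g)"
    "\<And>s t. a \<le> s \<Longrightarrow> s \<le> t \<Longrightarrow> t \<le> b \<Longrightarrow> (LINT r:{s..t}|lborel. g r) = integral {s..t} g"
    using AC_curve_control[OF AC] by metis
  have gi: "g integrable_on {a..b}"
    by (rule set_borel_integral_eq_integral(1)[OF g(4)])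
  have "enn2ereal (d' (x s) (x t)) \<le> ereal (LINT r:{s..t}|lborel. g r)"
    if st: "a \<le> s" "s \<le> t" "t \<le> b" for s t
  proof -
    have gst: "g integrable_on {s..t}"
      using st by (intro integrable_on_subinterval[OF gi]) auto
    have "unit_arc d (integral {s..t} g) (x s) (x t)"
      using st by (intro unit_arc_of_integral_control[OF d gst g(1) g(5)]) auto
    then have "d' (x s) (x t) \<le> ennreal (integral {s..t} g)" by (rule d')
    moreover have "0 \<le> integral {s..t} g"
      using g(1) by (intro Henstock_Kurzweil_Integration.integral_nonneg gst) auto
    ultimately have "enn2ereal (d' (x s) (x t)) \<le> ereal (integral {s..t} g)"
      by (metis enn2ereal_ennreal less_eq_ennreal.rep_eq)
    with g(6)[OF st] show ?thesis by simp
  qed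
  moreover have "\<forall>t\<in>{a..b}. x t \<in> Y" using AC(1) by (simp add: AC_curve_def)
  ultimately show ?thesis
    unfolding AC_curve_def using g(2,3) by (intro conjI exI[of _ g]) blast+
qed

subsection \<open>Metric derivative and length\<close>

text \<open>Stated from symmetry and the triangle inequality alone, so as to serve the new distance
  as well as \<open>d\<close>.\<close>

lemma enn2real_dist_diff_le:
  assumes sym: "\<And>x y. d x y = d y x" and tri: "\<And>x y z. d x z \<le> d x y + d y z"
    and "d x y \<le> ennreal e" "0 \<le> e" "d y w < \<infinity>"
  shows "d x w < \<infinity>" "\<bar>enn2real (d x w) - enn2real (d y w)\<bar> \<le> e"
proof -
  have xy: "d x y < \<infinity>" using assms(3) by (auto intro: le_less_trans)
  have 1: "d x w \<le> d x y + d y w" by (rule tri)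
  have 2: "d y w \<le> d x y + d x w"
    using tri[of y w x] sym[of y x] by simp
  show xw: "d x w < \<infinity>" using 1 xy assms(5) by (auto intro: le_less_trans)
  obtain A B C where "d x y = ennreal A" "0 \<le> A" "d x w = ennreal B" "0 \<le> B"
    "d y w = ennreal C" "0 \<le> C"
    using xy xw assms(5) by (metis ennreal_cases infinity_ennreal_def less_irrefl)
  then show "\<bar>enn2real (d x w) - enn2real (d y w)\<bar> \<le> e"
    using 1 2 assms(3,4) by (simp flip: ennreal_plus)
qed

lemma continuous_on_enn2real_dist:
  fixes a b :: real
  assumes d: "ext_metric d"
    and cont: "\<And>t e. t \<in> {a..b} \<Longrightarrow> 0 < e \<Longrightarrow>
      \<exists>r>0. \<forall>s\<in>{a..b}. \<bar>s - t\<bar> < r \<longrightarrow> d (x s) (x t) \<le> ennreal e"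
    and fin: "\<And>t. t \<in> {a..b} \<Longrightarrow> d (x t) y < \<infinity>"
  shows "continuous_on {a..b} (\<lambda>t. enn2real (d (x t) y))"
  unfolding continuous_on_iff dist_real_def
proof (intro ballI allI impI)
  fix t e :: real assume t: "t \<in> {a..b}" and "0 < e"
  then obtain r where "0 < r" and r: "\<And>s. s \<in> {a..b} \<Longrightarrow> \<bar>s - t\<bar> < r \<Longrightarrow> d (x s) (x t) \<le> ennreal (e / 2)"
    using cont[OF t, of "e / 2"] by auto
  have "\<bar>enn2real (d (x s) y) - enn2real (d (x t) y)\<bar> < e" if "s \<in> {a..b}" "\<bar>s - t\<bar> < r" for s
    using enn2real_dist_diff_le(2)[of d, OF ext_metric_sym[OF d] ext_metric_triangle[OF d] r[OF that] _ fin[OF t]] \<open>0 < e\<close> by simp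
  with \<open>0 < r\<close> show "\<exists>r>0. \<forall>s\<in>{a..b}. \<bar>s - t\<bar> < r \<longrightarrow>
      \<bar>enn2real (d (x s) y) - enn2real (d (x t) y)\<bar> < e" by blast
qed

text \<open>Difference quotients are continuous in \<open>t\<close> off the diagonal. Since
  \<open>v\<close> lies in the ball around \<open>t\<close> iff \<open>t\<close> lies in the ball
  around \<open>v\<close>, the supremum over a punctured ball has relatively open superlevel sets,
  although it runs over uncountably many \<open>v\<close>. The limsup is then an infimum over
  countably many radii.\<close>

lemma metric_derivative_measurable:
  fixes a b :: real
  assumes d: "ext_metric d"
    and cont: "\<And>t e. t \<in> {a..b} \<Longrightarrow> 0 < e \<Longrightarrow>
      \<exists>r>0. \<forall>s\<in>{a..b}. \<bar>s - t\<bar> < r \<longrightarrow> d (x s) (x t) \<le> ennreal e"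
    and fin: "\<And>s t. s \<in> {a..b} \<Longrightarrow> t \<in> {a..b} \<Longrightarrow> d (x s) (x t) < \<infinity>"
  shows "(\<lambda>t. metric_derivative d {a..b} x t * indicator {a..b} t) \<in> borel_measurable borel"
proof -
  let ?I = "{a..b}"
  define q where "q = (\<lambda>v t. d (x v) (x t) / ennreal \<bar>v - t\<bar>)"
  define h where "h = (\<lambda>e t. SUP v\<in>?I \<inter> ball t e - {t}. q v t)"
  have mono: "h e t \<le> h e' t" if "e \<le> e'" for e e' t
    unfolding h_def using that by (intro SUP_subset_mono) auto
  have eq: "metric_derivative d ?I x t = (INF n::nat. h (inverse (Suc n)) t)" for t
  proof -
    have "metric_derivative d ?I x t = (INF e\<in>{0<..}. h e t)"
      by (simp add: metric_derivative_def Limsup_within h_def q_def)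
    also have "\<dots> = (INF n::nat. h (inverse (Suc n)) t)"
    proof (rule antisym)
      show "(INF e\<in>{0<..}. h e t) \<le> (INF n::nat. h (inverse (Suc n)) t)"
        by (rule INF_mono) (metis greaterThan_iff inverse_positive_iff_positive
            of_nat_0_less_iff order_refl zero_less_Suc)
      show "(INF n::nat. h (inverse (Suc n)) t) \<le> (INF e\<in>{0<..}. h e t)"
      proof (rule INF_mono)
        fix e :: real assume "e \<in> {0<..}"
        then obtain n where "inverse (real (Suc n)) < e"
          using reals_Archimedean by auto
        then show "\<exists>n\<in>UNIV. h (inverse (real (Suc n))) t \<le> h e t"
          by (intro bexI[of _ n] mono) auto
      qed
    qed
    finally show ?thesis .
  qed
  have meas: "(\<lambda>t. h e t * indicator ?I t) \<in> borel_measurable borel" for e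
  proof (rule borel_measurableI_greater)
    fix y :: ennreal
    define U where "U = (\<lambda>v. {t\<in>?I - {v}. y < q v t} \<inter> (?I \<inter> ball v e))"
    have "openin (top_of_set ?I) (U v)" if v: "v \<in> ?I" for v
    proof -
      have "continuous_on ?I (\<lambda>t. enn2real (d (x t) (x v)))"
        using fin v by (intro continuous_on_enn2real_dist[OF d cont]) auto
      then have "continuous_on (?I - {v}) (\<lambda>t. ennreal (enn2real (d (x t) (x v)) / \<bar>v - t\<bar>))"
        by (intro continuous_intros continuous_on_ennreal) (auto intro: continuous_on_subset)
      moreover have "ennreal (enn2real (d (x t) (x v)) / \<bar>v - t\<bar>) = q v t" if "t \<in> ?I - {v}" for t
        using fin[of t v] v that
        by (simp add: q_def ext_metric_sym[OF d, of "x v"] flip: divide_ennreal)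
      ultimately have "continuous_on (?I - {v}) (q v)"
        by (metis (mono_tags, lifting) continuous_on_cong)
      then have "openin (top_of_set (?I - {v})) ((?I - {v}) \<inter> q v -` {y<..})"
        by (intro continuous_openin_preimage_gen) auto
      moreover have "(?I - {v}) \<inter> q v -` {y<..} = {t\<in>?I - {v}. y < q v t}" by auto
      moreover have "openin (top_of_set ?I) (?I - {v})"
        by (metis Diff_eq open_Compl closed_singleton openin_open_Int)
      ultimately have "openin (top_of_set ?I) {t\<in>?I - {v}. y < q v t}"
        by (metis openin_trans)
      then show ?thesis
        unfolding U_def by (intro openin_Int openin_open_Int) auto
    qed
    then have "openin (top_of_set ?I) (\<Union>v\<in>?I. U v)"
      by (intro openin_Union) auto
    then have "(\<Union>v\<in>?I. U v) \<in> sets borel"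
      by (auto simp: openin_open)
    moreover have "{t \<in> space borel. y < h e t * indicator ?I t} = (\<Union>v\<in>?I. U v)"
      by (auto simp: U_def h_def less_SUP_iff dist_commute indicator_def split: if_splits)
    ultimately show "{t \<in> space borel. y < h e t * indicator ?I t} \<in> sets borel" by simp
  qed
  have "(\<lambda>t. INF n::nat. h (inverse (Suc n)) t * indicator ?I t) \<in> borel_measurable borel"
    using meas by (intro borel_measurable_INF) auto
  also have "(\<lambda>t. INF n::nat. h (inverse (Suc n)) t * indicator ?I t) =
      (\<lambda>t. metric_derivative d ?I x t * indicator ?I t)"
    by (auto simp: eq indicator_def fun_eq_iff)
  finally show ?thesis .
qed

lemma metric_derivativeD:
  assumes d: "ext_metric d" and fin: "\<And>s t. s \<in> I \<Longrightarrow> t \<in> I \<Longrightarrow> d (x s) (x t) < \<infinity>"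
    and u: "u \<in> I" and m: "metric_derivative d I x u < \<infinity>" and "0 < e"
  shows "\<exists>r>0. \<forall>v\<in>I. \<bar>v - u\<bar> < r \<longrightarrow>
    enn2real (d (x v) (x u)) \<le> (enn2real (metric_derivative d I x u) + e) * \<bar>v - u\<bar>"
proof -
  define l where "l = enn2real (metric_derivative d I x u)"
  have l: "metric_derivative d I x u = ennreal l" "0 \<le> l"
    using m by (simp_all add: l_def)
  then have "metric_derivative d I x u < ennreal (l + e)"
    using \<open>0 < e\<close> by (simp add: ennreal_less_iff)
  then have "eventually (\<lambda>v. d (x v) (x u) / ennreal \<bar>v - u\<bar> < ennreal (l + e)) (at u within I)"
    unfolding metric_derivative_def by (rule Limsup_lessD)
  then obtain r where "0 < r" and r: "\<And>v. v \<in> I \<Longrightarrow> v \<noteq> u \<Longrightarrow> \<bar>v - u\<bar> < r \<Longrightarrow>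
      d (x v) (x u) / ennreal \<bar>v - u\<bar> < ennreal (l + e)"
    unfolding eventually_at dist_real_def by blast
  have "enn2real (d (x v) (x u)) \<le> (l + e) * \<bar>v - u\<bar>" if v: "v \<in> I" "\<bar>v - u\<bar> < r" for v
  proof (cases "v = u")
    case True
    then show ?thesis by (simp add: ext_metric_refl[OF d])
  next
    case False
    obtain D where D: "d (x v) (x u) = ennreal D" "0 \<le> D"
      using fin[OF v(1) u] by (metis ennreal_cases infinity_ennreal_def less_irrefl)
    then have "ennreal (D / \<bar>v - u\<bar>) < ennreal (l + e)"
      using r[OF v(1) False v(2)] False by (simp add: divide_ennreal)
    then have "D / \<bar>v - u\<bar> < l + e"
      using D by (subst (asm) ennreal_less_iff) auto
    then show ?thesis using False D by (simp add: field_simps)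
  qed
  with \<open>0 < r\<close> show ?thesis unfolding l_def by blast
qed

text \<open>Absolute continuity controls the curve by some \<open>g\<close>, whereas its length
  integrates the metric derivative. The point is that the metric derivative controls the distances
  too; it then serves as the speed in the reparametrisation.\<close>

lemma unit_arc_of_AC_length_dist_less:
  assumes d: "ext_metric d" and less: "AC_length_dist d y z < ennreal c"
  shows "unit_arc d c y z"
proof -
  obtain x where x: "AC_curve 1 d UNIV 0 1 x" "x 0 = y" "x 1 = z"
    and len: "(\<integral>\<^sup>+t\<in>{0..1}. metric_derivative d {0..1} x t \<partial>lborel) < ennreal c"
    using less unfolding AC_length_dist_def Inf_less_iff by blast
  let ?I = "{0..1::real}"
  obtain g where g0: "\<And>t. 0 \<le> g t" and gm: "set_borel_measurable lborel ?I g"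
    and gi: "set_integrable lborel ?I g"
    and dg: "\<And>s t. 0 \<le> s \<Longrightarrow> s \<le> t \<Longrightarrow> t \<le> 1 \<Longrightarrow> d (x s) (x t) \<le> ennreal (integral {s..t} g)"
    using AC_curve_control[OF x(1)] by (metis order_refl)
  have gI: "g integrable_on ?I"
    by (rule set_borel_integral_eq_integral(1)[OF gi])
  note cont = integral_control_continuous[OF d gI dg]
  have fin: "d (x s) (x t) < \<infinity>" if "s \<in> ?I" "t \<in> ?I" for s t
  proof (cases "s \<le> t")
    case True
    then show ?thesis using dg[of s t] that by (auto intro: le_less_trans)
  next
    case False
    then show ?thesis using dg[of t s] that ext_metric_sym[OF d, of "x s" "x t"]
      by (auto intro: le_less_trans)
  qed
  define M where "M = (\<lambda>t. metric_derivative d ?I x t * indicator ?I t)"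
  have M[measurable]: "M \<in> borel_measurable borel"
    unfolding M_def by (rule metric_derivative_measurable[OF d cont fin])
  have [measurable]: "(\<lambda>t. indicator ?I t * g t) \<in> borel_measurable borel"
    using gm by (simp add: set_borel_measurable_def)
  have lenM: "(\<integral>\<^sup>+t. M t \<partial>lborel) < ennreal c" using len by (simp add: M_def)
  have "AE t in lborel. M t \<noteq> \<infinity>"
    using lenM by (intro nn_integral_noteq_infinite) auto
  \<comment> \<open>The metric derivative may be infinite on a null set. There \<mu> falls back on
    \<open>g\<close>, the alternative that \<open>increment_le_integral_of_derivative_bound\<close>
    admits; the integral is unchanged.\<close>
  define \<mu> where "\<mu> = (\<lambda>t. if M t = \<infinity> then indicator ?I t * g t else enn2real (M t))"
  have \<mu>0: "0 \<le> \<mu> t" for t using g0 by (simp add: \<mu>_def)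
  have \<mu>_meas: "\<mu> \<in> borel_measurable borel"
    unfolding \<mu>_def by measurable
  obtain l where l: "(\<integral>\<^sup>+t. M t \<partial>lborel) = ennreal l" "0 \<le> l" "l < c"
    using lenM by (cases "\<integral>\<^sup>+t. M t \<partial>lborel") (auto simp: ennreal_less_iff)
  have "(\<integral>\<^sup>+t. \<mu> t \<partial>lborel) = (\<integral>\<^sup>+t. M t \<partial>lborel)"
    using \<open>AE t in lborel. M t \<noteq> \<infinity>\<close> by (intro nn_integral_cong_AE) (auto simp: \<mu>_def less_top)
  then have "(\<mu> has_integral l) UNIV"
    using l by (intro nn_integral_has_integral \<mu>_meas \<mu>0) auto
  moreover have "\<mu> = (\<lambda>t. if t \<in> ?I then \<mu> t else 0)"
    by (auto simp: \<mu>_def M_def fun_eq_iff)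
  ultimately have \<mu>I: "(\<mu> has_integral l) ?I"
    by (metis has_integral_restrict_UNIV)
  have d\<mu>: "d (x s) (x t) \<le> ennreal (integral {s..t} \<mu>)" if st: "0 \<le> s" "s \<le> t" "t \<le> 1" for s t
  proof -
    \<comment> \<open>The increment lemma is about real functions. The distance from the fixed point
      \<open>x s\<close> is one, and its increments are bounded by distances along the
      curve.\<close>
    define f where "f = (\<lambda>v. enn2real (d (x s) (x v)))"
    have f_diff: "\<bar>f v - f u\<bar> \<le> enn2real (d (x u) (x v))" if "u \<in> ?I" "v \<in> ?I" for u v
    proof -
      have "d (x v) (x u) \<le> ennreal (enn2real (d (x u) (x v)))"
        using fin[OF that] ext_metric_sym[OF d, of "x u"] by simp
      then show ?thesis
        using enn2real_dist_diff_le(2)[of d "x v" "x u" _ "x s", OF ext_metric_sym[OF d] ext_metric_triangle[OF d]] fin[of u s] that st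
        by (simp add: f_def ext_metric_sym[OF d, of "x s"])
    qed
    have "f t - f s \<le> integral {s..t} \<mu>"
    proof (rule increment_le_integral_of_derivative_bound[OF st(2), of g])
      show "g integrable_on {s..t}" "\<mu> integrable_on {s..t}"
        using st gI \<mu>I by (auto intro: integrable_on_subinterval)
    next
      fix u v assume uv: "s \<le> u" "u \<le> v" "v \<le> t"
      have "0 \<le> integral {u..v} g"
        using uv st g0 by (intro Henstock_Kurzweil_Integration.integral_nonneg
            integrable_on_subinterval[OF gI]) auto
      then have "enn2real (d (x u) (x v)) \<le> integral {u..v} g"
        using dg[of u v] uv st by (intro enn2real_leI) auto
      then show "f v - f u \<le> integral {u..v} g"
        using f_diff[of u v] uv st by auto
    next
      fix u assume "u \<in> {s..t}"
      then have u: "u \<in> ?I" using st by auto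
      show "\<mu> u = g u \<or> (\<forall>e>0. \<exists>r>0. \<forall>v\<in>{s..t}. \<bar>v - u\<bar> < r \<longrightarrow>
          \<bar>f v - f u\<bar> \<le> (\<mu> u + e) * \<bar>v - u\<bar>)"
      proof (cases "M u = \<infinity>")
        case True
        then show ?thesis using u by (simp add: \<mu>_def)
      next
        case False
        then have \<mu>u: "\<mu> u = enn2real (metric_derivative d ?I x u)"
          and m: "metric_derivative d ?I x u < \<infinity>"
          using u by (auto simp: \<mu>_def M_def less_top)
        show ?thesis
        proof (intro disjI2 allI impI)
          fix e :: real assume "0 < e"
          then obtain r where "0 < r" and r: "\<And>v. v \<in> ?I \<Longrightarrow> \<bar>v - u\<bar> < r \<Longrightarrow>
              enn2real (d (x v) (x u)) \<le> (\<mu> u + e) * \<bar>v - u\<bar>"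
            using metric_derivativeD[OF d fin u m] \<mu>u by metis
          have "\<bar>f v - f u\<bar> \<le> (\<mu> u + e) * \<bar>v - u\<bar>" if "v \<in> {s..t}" "\<bar>v - u\<bar> < r" for v
            using f_diff[of u v] r[of v] that u st ext_metric_sym[OF d, of "x u" "x v"] by auto
          with \<open>0 < r\<close> show "\<exists>r>0. \<forall>v\<in>{s..t}. \<bar>v - u\<bar> < r \<longrightarrow>
              \<bar>f v - f u\<bar> \<le> (\<mu> u + e) * \<bar>v - u\<bar>" by blast
        qed
      qed
    qed
    then have "enn2real (d (x s) (x t)) \<le> integral {s..t} \<mu>"
      by (simp add: f_def ext_metric_refl[OF d])
    then have "ennreal (enn2real (d (x s) (x t))) \<le> ennreal (integral {s..t} \<mu>)"
      by (rule ennreal_leI)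
    then show ?thesis using fin[of s t] st by simp
  qed
  have "unit_arc d c (x 0) (x 1)"
    using \<mu>I l(3) integral_unique[OF \<mu>I] by (intro unit_arc_of_integral_control[OF d _ \<mu>0 d\<mu>]) auto
  with x show ?thesis by simp
qed

lemma AC_length_dist_le:
  assumes d: "ext_metric d" and arc: "unit_arc d c y z"
  shows "AC_length_dist d y z \<le> ennreal c"
proof -
  obtain \<gamma> where c: "0 \<le> c" and \<gamma>: "\<gamma> 0 = y" "\<gamma> c = z"
    "\<And>s t. 0 \<le> s \<Longrightarrow> s \<le> t \<Longrightarrow> t \<le> c \<Longrightarrow> d (\<gamma> s) (\<gamma> t) \<le> ennreal (t - s)"
    using arc unfolding unit_arc_def by blast
  define x where "x = (\<lambda>t. \<gamma> (c * t))"
  have lip: "d (x s) (x t) \<le> ennreal (c * (t - s))" if "0 \<le> s" "s \<le> t" "t \<le> 1" for s t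
    using \<gamma>(3)[of "c * s" "c * t"] that c
    by (simp add: x_def right_diff_distrib mult_left_mono mult_left_le)
  have "AC_curve 1 d UNIV 0 1 x"
    unfolding AC_curve_def
  proof (intro conjI exI[of _ "\<lambda>_. c"] allI impI)
    fix s t :: real assume st: "0 \<le> s \<and> s \<le> t \<and> t \<le> 1"
    then have "enn2ereal (d (x s) (x t)) \<le> ereal (c * (t - s))"
      using lip[of s t] c by (metis enn2ereal_ennreal less_eq_ennreal.rep_eq
          diff_ge_0_iff_ge mult_nonneg_nonneg)
    also have "c * (t - s) = (LINT r:{s..t}|lborel. c)"
      using st by (simp add: set_lebesgue_integral_def)
    finally show "enn2ereal (d (x s) (x t)) \<le> ereal (LINT r:{s..t}|lborel. c)" .
  qed (auto simp: set_borel_measurable_def set_integrable_def)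
  moreover have "(\<integral>\<^sup>+t\<in>{0..1}. metric_derivative d {0..1} x t \<partial>lborel) \<le> ennreal c"
  proof -
    have m: "metric_derivative d {0..1} x t \<le> ennreal c" if t: "t \<in> {0..1}" for t
      unfolding metric_derivative_def
    proof (rule Limsup_bounded)
      have "d (x s) (x t) / ennreal \<bar>s - t\<bar> \<le> ennreal c" if s: "s \<in> {0..1}" "s \<noteq> t" for s
      proof -
        have "d (x s) (x t) \<le> ennreal c * ennreal \<bar>s - t\<bar>"
          using lip[of s t] lip[of t s] s t c
          by (cases "s \<le> t") (auto simp: ext_metric_sym[OF d] simp flip: ennreal_mult)
        then show ?thesis
          using s by (intro divide_le_posI_ennreal) (auto simp: mult.commute)
      qed
      then show "eventually (\<lambda>s. d (x s) (x t) / ennreal \<bar>s - t\<bar> \<le> ennreal c) (at t within {0..1})"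
        by (auto simp: eventually_at intro!: exI[of _ 1])
    qed
    have "(\<integral>\<^sup>+t\<in>{0..1}. metric_derivative d {0..1} x t \<partial>lborel) \<le> (\<integral>\<^sup>+t\<in>{0..1::real}. ennreal c \<partial>lborel)"
      using m by (intro nn_integral_mono) (auto simp: indicator_def)
    also have "\<dots> = ennreal c"
      by (simp add: nn_integral_cmult_indicator)
    finally show ?thesis .
  qed
  moreover have "x 0 = y" "x 1 = z" using \<gamma> by (auto simp: x_def)
  ultimately show ?thesis
    unfolding AC_length_dist_def by (intro Inf_lower2[rotated]) blast+
qed

subsection \<open>The flow\<close>

locale EVI_flow_on_space =
  fixes d :: "'a \<Rightarrow> 'a \<Rightarrow> ennreal" and K :: real
    and F :: "'a \<Rightarrow> ereal" and S :: "real \<Rightarrow> 'a \<Rightarrow> 'a"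
  assumes metric: "ext_metric d"
    and F_ninf: "\<And>x. F x \<noteq> -\<infinity>"
    and flow: "EVI_flow d K F UNIV S"
begin

text \<open>At points of infinite energy this has the default value 0, so it carries information
  only on \<open>edom F\<close>.\<close>

definition E :: "'a \<Rightarrow> real" where "E x = real_of_ereal (F x)"

lemma F_eq: "x \<in> edom F \<Longrightarrow> F x = ereal (E x)"
  using F_ninf[of x] by (cases "F x") (auto simp: edom_def E_def)

lemma S_0 [simp]: "S 0 x = x"
  and S_add: "0 \<le> s \<Longrightarrow> 0 \<le> t \<Longrightarrow> S (s + t) x = S s (S t x)"
  and S_contraction: "0 \<le> t \<Longrightarrow> d (S t x) (S t y) \<le> ennreal (exp (- K * t)) * d x y"
  and S_curve: "EVI_curve d K F (\<lambda>t. S t x)"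
  and S_starts: "starts_from d F (\<lambda>t. S t x) x"
  using flow unfolding EVI_flow_def by auto

lemma S_AC: "0 < a \<Longrightarrow> a \<le> b \<Longrightarrow> AC_curve 2 d (edom F) a b (\<lambda>t. S t x)"
  and S_lsc: "0 < t \<Longrightarrow> F (S t x) \<le> Liminf (at t) (\<lambda>s. F (S s x))"
  using S_curve[of x] unfolding EVI_curve_def by auto

lemma S_edom: "0 < t \<Longrightarrow> S t x \<in> edom F"
  using S_AC[of t t x] unfolding AC_curve_def by auto

text \<open>Semicontinuity is enough for the limits at small times, because \<open>E (S h x)\<close>
  enters the estimates with a negative sign.\<close>

lemma S_lsc_0:
  assumes "x \<in> edom F" "0 < e"
  shows "eventually (\<lambda>h. E x - e < E (S h x)) (at_right 0)"
proof -
  have "F x \<le> Liminf (at_right 0) (\<lambda>t. F (S t x))"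
    using S_starts[of x] by (simp add: starts_from_def)
  moreover have "ereal (E x - e) < F x" using assms by (simp add: F_eq)
  ultimately have "eventually (\<lambda>h. ereal (E x - e) < F (S h x)) (at_right 0)"
    by (simp add: le_Liminf_iff)
  then show ?thesis
    using eventually_at_right_less[of 0]
    by eventually_elim (simp add: F_eq[OF S_edom])
qed

section \<open>Finiteness and continuity of distances along the flow\<close>

lemma S_finite_less:
  assumes "0 < s" "s \<le> t"
  shows "d (S s x) (S t x) < \<infinity>"
proof -
  obtain g where "\<And>u v. s \<le> u \<Longrightarrow> u \<le> v \<Longrightarrow> v \<le> t \<Longrightarrow>
      d (S u x) (S v x) \<le> ennreal (integral {u..v} g)"
    using AC_curve_control[OF S_AC[OF assms]] by (metis one_le_numeral)
  then have "d (S s x) (S t x) \<le> ennreal (integral {s..t} g)" using assms by simp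
  then show ?thesis by (rule le_less_trans) simp
qed

lemma S_finite:
  assumes "0 < s" "0 < t"
  shows "d (S s x) (S t x) < \<infinity>"
  using S_finite_less[of s t x] S_finite_less[of t s x] assms
    ext_metric_sym[OF metric, of "S s x" "S t x"] by (cases "s \<le> t") auto

lemma S_continuous:
  assumes "0 < a" "t \<in> {a..b}" "0 < e"
  shows "\<exists>r>0. \<forall>s\<in>{a..b}. \<bar>s - t\<bar> < r \<longrightarrow> d (S s x) (S t x) \<le> ennreal e"
proof -
  have "a \<le> b" using assms(2) by simp
  obtain g where g: "set_integrable lborel {a..b} g" "\<And>u v. a \<le> u \<Longrightarrow> u \<le> v \<Longrightarrow> v \<le> b \<Longrightarrow>
      d (S u x) (S v x) \<le> ennreal (integral {u..v} g)"
    using AC_curve_control[OF S_AC[OF assms(1) \<open>a \<le> b\<close>, of x]] by (metis one_le_numeral)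
  show ?thesis
    by (rule integral_control_continuous[OF metric
          set_borel_integral_eq_integral(1)[OF g(1)] g(2) assms(2,3)])
qed

lemma edom_subset_closure: "edom F \<subseteq> ext_closure d (edom F)"
proof
  fix x assume "x \<in> edom F"
  then have "\<exists>y\<in>edom F. d x y < e" if "0 < e" for e
    using that by (intro bexI[of _ x]) (simp_all add: ext_metric_refl[OF metric])
  then show "x \<in> ext_closure d (edom F)" by (simp add: ext_closure_def)
qed

context
  fixes x v :: 'a
  assumes v: "v \<in> edom F" and fin: "d x v < \<infinity>"
begin

lemma S_dist_tendsto: "((\<lambda>t. d (S t x) v) \<longlongrightarrow> d x v) (at_right 0)"
  using S_starts[of x] v edom_subset_closure by (auto simp: starts_from_def)

lemma S_dist_finite:
  assumes "0 \<le> t" shows "d (S t x) v < \<infinity>"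
proof (cases "t = 0")
  case True
  then show ?thesis using fin by simp
next
  case False
  have "eventually (\<lambda>s. d (S s x) v < \<infinity> \<and> 0 < s) (at_right 0)"
    using order_tendstoD(2)[OF S_dist_tendsto fin] eventually_at_right_less
    by (rule eventually_conj)
  then obtain s where s: "d (S s x) v < \<infinity>" "0 < s"
    using eventually_happens trivial_limit_at_right_real by blast
  then have "d (S t x) (S s x) < \<infinity>" using S_finite False assms by simp
  then show ?thesis
    using s ext_metric_triangle[OF metric, of "S t x" v "S s x"] by (auto intro: le_less_trans)
qed

lemma S_dist_continuous: "continuous_on {0..b} (\<lambda>t. enn2real (d (S t x) v))"
  unfolding continuous_on
proof
  fix t assume t: "t \<in> {0..b}"
  show "((\<lambda>t. enn2real (d (S t x) v)) \<longlongrightarrow> enn2real (d (S t x) v)) (at t within {0..b})"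
  proof (cases "t = 0")
    case True
    have "((\<lambda>t. enn2real (d (S t x) v)) \<longlongrightarrow> enn2real (d x v)) (at_right 0)"
      using S_dist_tendsto fin by (intro tendsto_enn2real) auto
    then have "((\<lambda>t. enn2real (d (S t x) v)) \<longlongrightarrow> enn2real (d x v)) (at 0 within {0..b})"
      unfolding at_within_def by (rule tendsto_mono[OF inf_mono[OF order_refl], rotated]) auto
    then show ?thesis using True by simp
  next
    case False
    have "continuous_on {t / 2..b + 1} (\<lambda>t. enn2real (d (S t x) v))"
      using t False by (intro continuous_on_enn2real_dist[OF metric S_continuous] S_dist_finite) auto
    moreover have "t \<in> interior {t / 2..b + 1}"
      using t False by simp
    ultimately have "isCont (\<lambda>t. enn2real (d (S t x) v)) t"
      by (rule continuous_on_interior)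
    then show ?thesis
      unfolding isCont_def by (rule tendsto_within_subset) simp
  qed
qed

text \<open>The bound \<open>c\<close> on the energy gap is left free: it is 0 in the proof that the
  energy decays, and afterwards the gap at the final time.\<close>

lemma S_gronwall:
  assumes "0 \<le> b" and c: "\<And>t. 0 < t \<Longrightarrow> t < b \<Longrightarrow> E v - E (S t x) \<le> c"
  shows "exp (K * b) * (enn2real (d (S b x) v))\<^sup>2 \<le> (enn2real (d x v))\<^sup>2 + 2 * c * expint K b"
proof -
  define f where "f = (\<lambda>t. 1/2 * (enn2real (d (S t x) v))\<^sup>2)"
  have "exp (K * b) * f b \<le> f 0 + c * expint K b"
  proof (rule dini_gronwall[OF \<open>0 \<le> b\<close>])
    show "continuous_on {0..b} f"
      unfolding f_def by (intro continuous_intros S_dist_continuous)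
    fix t assume t: "0 < t" "t < b"
    have "upper_right_derivative f t + ereal (K/2 * (enn2real (d (S t x) v))\<^sup>2) \<le> F v - F (S t x)"
      using S_curve[of x] v t S_dist_finite[of t]
      unfolding EVI_curve_def f_def by (auto simp: ext_metric_sym[OF metric, of v])
    also have "\<dots> = ereal (E v - E (S t x))"
      using v S_edom[OF t(1)] by (simp add: F_eq)
    also have "\<dots> \<le> ereal c" using c[OF t] by simp
    finally show "upper_right_derivative f t \<le> ereal (c - K * f t)"
      by (cases "upper_right_derivative f t") (auto simp: f_def)
  qed
  then show ?thesis by (simp add: f_def)
qed

end

text \<open>If the energy exceeded its initial value on a whole interval, the EVI tested with the
  initial point itself would freeze the curve.\<close>
lemma E_return:
  assumes w: "w \<in> edom F" and "0 < T"
  shows "\<exists>r. 0 < r \<and> r < T \<and> E (S r w) \<le> E w"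
proof (rule ccontr)
  assume "\<not> ?thesis"
  then have gt: "E w < E (S r w)" if "0 < r" "r < T" for r using that by force
  define b where "b = T / 2"
  have b: "0 < b" "b < T" using \<open>0 < T\<close> by (simp_all add: b_def)
  have fin: "d w w < \<infinity>" by (simp add: ext_metric_refl[OF metric])
  have "exp (K * b) * (enn2real (d (S b w) w))\<^sup>2 \<le> (enn2real (d w w))\<^sup>2 + 2 * 0 * expint K b"
    using gt b by (intro S_gronwall[OF w fin]) force+
  then have "enn2real (d (S b w) w) = 0"
    by (simp add: ext_metric_refl[OF metric] mult_le_0_iff not_le[symmetric])
  then have "S b w = w"
    using S_dist_finite[OF w fin, of b] b
    by (auto simp: enn2real_eq_0_iff ext_metric_zero_iff[OF metric])
  with gt[OF b] show False by simp
qed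

text \<open>Consider the supremum of the times at which the energy does not exceed its initial
  value. Lower semicontinuity shows that it is attained, and \<open>E_return\<close>, restarted
  there, would produce a later such time.\<close>

lemma E_antimono_0:
  assumes w: "w \<in> edom F" and "0 \<le> T"
  shows "E (S T w) \<le> E w"
proof (rule ccontr)
  assume bad: "\<not> ?thesis"
  define A where "A = {r\<in>{0..T}. E (S r w) \<le> E w}"
  have A: "0 \<in> A" "bdd_above A"
    using \<open>0 \<le> T\<close> by (auto simp: A_def intro!: bdd_aboveI[of _ T])
  define r where "r = Sup A"
  have r: "0 \<le> r" "r \<le> T"
    unfolding r_def using A by (auto simp: A_def intro!: cSup_upper cSup_least)
  have rA: "E (S r w) \<le> E w"
  proof (rule ccontr)
    assume gt: "\<not> E (S r w) \<le> E w"
    then have "0 < r" using r by (cases "r = 0") auto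
    have "ereal (E w) < F (S r w)" using gt \<open>0 < r\<close> by (simp add: F_eq[OF S_edom])
    then have "eventually (\<lambda>s. ereal (E w) < F (S s w)) (at r)"
      using S_lsc[OF \<open>0 < r\<close>, of w] by (simp add: le_Liminf_iff)
    then obtain e where "0 < e" and e: "\<And>s. s \<noteq> r \<Longrightarrow> \<bar>s - r\<bar> < e \<Longrightarrow> ereal (E w) < F (S s w)"
      by (auto simp: eventually_at dist_real_def)
    have "max 0 (r - e) < r" using \<open>0 < r\<close> \<open>0 < e\<close> by simp
    then obtain s where s: "s \<in> A" "max 0 (r - e) < s"
      using less_cSup_iff[of A "max 0 (r - e)"] A unfolding r_def by auto
    moreover have "s \<le> r" unfolding r_def using s A by (intro cSup_upper)
    moreover have "s \<noteq> r" using s gt by (auto simp: A_def)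
    ultimately have "ereal (E w) < F (S s w)" by (intro e) auto
    then show False using s by (auto simp: A_def F_eq[OF S_edom])
  qed
  have "r < T" using bad rA r by (cases "r = T") auto
  have "S r w \<in> edom F" using w S_edom[of r w] r by (cases "r = 0") auto
  then obtain q where q: "0 < q" "q < T - r" "E (S q (S r w)) \<le> E (S r w)"
    using E_return[of "S r w" "T - r"] \<open>r < T\<close> by auto
  then have "q + r \<in> A" using r rA by (auto simp: A_def S_add)
  then have "q + r \<le> r" unfolding r_def using A by (intro cSup_upper)
  then show False using q by simp
qed

lemma E_antimono:
  assumes "0 < s" "s \<le> t"
  shows "E (S t x) \<le> E (S s x)"
  using E_antimono_0[OF S_edom[of s x], of "t - s"] assms S_add[of "t - s" s x] by simp

text \<open>As the energy decays, the gap \<open>E v - E (S r x)\<close> is largest at the final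
  time. For \<open>t = 0\<close> the energy of \<open>x\<close> may be infinite, but then
  \<open>expint K 0 = 0\<close> removes that term.\<close>

lemma integrated_EVI:
  assumes "v \<in> edom F" "d x v < \<infinity>" "0 \<le> t"
  shows "exp (K * t) * (enn2real (d (S t x) v))\<^sup>2
    \<le> (enn2real (d x v))\<^sup>2 + 2 * (E v - E (S t x)) * expint K t"
  using assms by (intro S_gronwall) (auto intro: E_antimono)

text \<open>Chosen so that its increment over \<open>[s, t]\<close> is \<open>t - s\<close> times the quadratic upper bound of
  \<open>exp (- K h (2 - s - t))\<close>, the contraction factor of neighbouring points.\<close>
definition drift :: "real \<Rightarrow> real \<Rightarrow> real" where
  "drift h t = (1 + 4 * K\<^sup>2 * h\<^sup>2) * t - K * h * (2 * t - t\<^sup>2)"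

lemma drift_0 [simp]: "drift h 0 = 0"
  and drift_1: "drift h 1 = 1 + 4 * K\<^sup>2 * h\<^sup>2 - K * h"
  by (simp_all add: drift_def)

lemma drift_diff: "drift h t - drift h s = (t - s) * (1 - K * h * (2 - s - t) + 4 * K\<^sup>2 * h\<^sup>2)"
  by (simp add: drift_def algebra_simps power2_eq_square)

text \<open>The ratio compares the two weights of the integrated EVI with 1 and the elapsed time.
  Below \<delta> it is 1 up to \<open>e\<close>, so the energy term can be made proportional to the
  elapsed time.\<close>

definition time_scale :: "real \<Rightarrow> real \<Rightarrow> bool" where
  "time_scale e \<delta> \<longleftrightarrow> 0 < \<delta> \<and> (\<forall>t. 0 < t \<and> t < \<delta> \<longrightarrow>
     1 - e \<le> exp (K * t) * t / expint K t \<and> exp (K * t) * t / expint K t \<le> 1 + e)"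

lemma time_scale_exists:
  assumes "0 < e" obtains \<delta> where "time_scale e \<delta>"
proof -
  have "eventually (\<lambda>t. 1 - e < exp (K * t) * t / expint K t) (at_right 0)"
    "eventually (\<lambda>t. exp (K * t) * t / expint K t < 1 + e) (at_right 0)"
    using order_tendstoD[OF tendsto_expint_ratio[of K]] assms by auto
  then have "eventually (\<lambda>t. 1 - e < exp (K * t) * t / expint K t \<and>
      exp (K * t) * t / expint K t < 1 + e) (at_right 0)" by (rule eventually_conj)
  then obtain \<delta> where "0 < \<delta>" "\<forall>t>0. t < \<delta> \<longrightarrow> 1 - e < exp (K * t) * t / expint K t \<and>
      exp (K * t) * t / expint K t < 1 + e"
    unfolding eventually_at_right_field by auto
  then have "time_scale e \<delta>" unfolding time_scale_def by (auto intro: less_imp_le)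
  then show thesis by (rule that)
qed

text \<open>Two neighbouring points are run for the times \<open>h (1 - s)\<close> and \<open>h (1 - t)\<close>: the common time
  \<open>h (1 - t)\<close> is estimated by contraction, the excess \<open>h (t - s)\<close> by the integrated EVI.\<close>
lemma pair_estimate:
  assumes st: "0 \<le> s" "s \<le> t" "t \<le> 1" and h: "0 < h" "\<bar>K\<bar> * h \<le> 1/2" and "0 \<le> L"
    and pq: "d p q \<le> ennreal (L * (t - s))" and "S (h * (1 - t)) q \<in> edom F"
    and e: "0 < e" "e < 1" and \<delta>: "time_scale e \<delta>" "h * (t - s) < \<delta>"
  defines "z \<equiv> S (h * (1 - s)) p" and "z' \<equiv> S (h * (1 - t)) q"
  shows "d z z' < \<infinity>"
    and "(1 - e) * (enn2real (d z z'))\<^sup>2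
      \<le> (t - s) * ((1 + e) * L\<^sup>2 * (drift h t - drift h s) + 2 * h * (E z' - E z))"
proof -
  define \<theta> where "\<theta> = h * (1 - t)"
  define \<tau> where "\<tau> = h * (t - s)"
  have \<theta>: "0 \<le> \<theta>" and \<tau>: "0 \<le> \<tau>" using st h by (simp_all add: \<theta>_def \<tau>_def)
  have z'_eq: "z' = S \<theta> q" by (simp add: z'_def \<theta>_def)
  have "h * (1 - s) = \<tau> + \<theta>" by (simp add: \<tau>_def \<theta>_def algebra_simps)
  then have z_eq: "z = S \<tau> (S \<theta> p)" using S_add[OF \<tau> \<theta>] by (simp add: z_def)
  have z': "z' \<in> edom F" using assms(8) by (simp add: z'_def)
  have "d (S \<theta> p) z' \<le> ennreal (exp (- K * \<theta>)) * ennreal (L * (t - s))"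
    unfolding z'_eq using S_contraction[OF \<theta>, of p q] pq
    by (meson mult_left_mono order_trans zero_le)
  also have "\<dots> = ennreal (exp (- K * \<theta>) * (L * (t - s)))"
    using \<open>0 \<le> L\<close> st by (intro ennreal_mult[symmetric]) auto
  finally have u: "d (S \<theta> p) z' \<le> ennreal (exp (- K * \<theta>) * (L * (t - s)))" .
  then have ufin: "d (S \<theta> p) z' < \<infinity>" by (rule le_less_trans) simp
  show "d z z' < \<infinity>" unfolding z_eq by (rule S_dist_finite[OF z' ufin \<tau>])
  have u': "enn2real (d (S \<theta> p) z') \<le> exp (- K * \<theta>) * (L * (t - s))"
    using u \<open>0 \<le> L\<close> st by (intro enn2real_leI) auto
  define a where "a = enn2real (d z z')"
  show "(1 - e) * (enn2real (d z z'))\<^sup>2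
      \<le> (t - s) * ((1 + e) * L\<^sup>2 * (drift h t - drift h s) + 2 * h * (E z' - E z))"
  proof (cases "s = t")
    \<comment> \<open>Here the excess time vanishes and cannot be divided by; but the two points
      coincide and both sides are 0.\<close>
    case True
    with pq have "d p q = 0" by simp
    then have "p = q" by (simp add: ext_metric_zero_iff[OF metric])
    with True show ?thesis by (simp add: z_def z'_def ext_metric_refl[OF metric])
  next
    case False
    then have "s < t" using st by simp
    then have "0 < \<tau>" using h by (simp add: \<tau>_def)
    define w where "w = exp (K * \<tau>) * \<tau> / expint K \<tau>"
    have w: "1 - e \<le> w" "w \<le> 1 + e"
      using \<delta> \<open>0 < \<tau>\<close> unfolding time_scale_def w_def \<tau>_def by auto
    have ep: "0 < expint K \<tau>" using \<open>0 < \<tau>\<close> by (rule expint_pos)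
    have "exp (K * \<tau>) * a\<^sup>2 \<le> (enn2real (d (S \<theta> p) z'))\<^sup>2 + 2 * (E z' - E z) * expint K \<tau>"
      unfolding a_def z_eq by (rule integrated_EVI[OF z' ufin \<tau>])
    also have "\<dots> \<le> (exp (- K * \<theta>) * (L * (t - s)))\<^sup>2 + 2 * (E z' - E z) * expint K \<tau>"
      using u' by (intro add_right_mono power_mono) auto
    \<comment> \<open>This factor turns the energy term into the plain difference times
      \<open>2 * \<tau>\<close>, without a weight depending on the mesh; only such terms telescope.
      The correction is collected in \<open>w\<close>.\<close>
    finally have "exp (K * \<tau>) * a\<^sup>2 * (\<tau> / expint K \<tau>)
        \<le> ((exp (- K * \<theta>) * (L * (t - s)))\<^sup>2 + 2 * (E z' - E z) * expint K \<tau>) * (\<tau> / expint K \<tau>)"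
      using ep \<tau> by (intro mult_right_mono) auto
    also have "\<dots> = (exp (- K * \<theta>) * (L * (t - s)))\<^sup>2 * (\<tau> / expint K \<tau>) + 2 * (E z' - E z) * \<tau>"
      using ep by (simp add: field_simps)
    also have "(exp (- K * \<theta>) * (L * (t - s)))\<^sup>2 * (\<tau> / expint K \<tau>)
        = w * (exp (- (K * h * (2 - s - t))) * L\<^sup>2 * (t - s)\<^sup>2)"
    proof -
      \<comment> \<open>Twice the common time plus the excess time is
        \<open>2 * \<theta> + \<tau> = h * (2 - s - t)\<close>.\<close>
      have "exp (- K * \<theta>) ^ 2 = exp (K * \<tau>) * exp (- (K * h * (2 - s - t)))"
        unfolding exp_add[symmetric] power2_eq_square
        by (rule arg_cong[where f = exp]) (simp add: \<theta>_def \<tau>_def algebra_simps)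
      then show ?thesis by (simp add: w_def power_mult_distrib)
    qed
    also have "\<dots> \<le> (1 + e) * ((1 - K * h * (2 - s - t) + 4 * K\<^sup>2 * h\<^sup>2) * L\<^sup>2 * (t - s)\<^sup>2)"
    proof -
      \<comment> \<open>Since \<open>2 - s - t\<close> lies between 0 and 2, smallness of
        \<open>h\<close> puts the exponent in the range of \<open>exp_le_quadratic\<close>, and the
        quadratic term is at most \<open>4 * K\<^sup>2 * h\<^sup>2\<close>.\<close>
      have "\<bar>K * h * (2 - s - t)\<bar> \<le> \<bar>K * h\<bar> * 2"
        unfolding abs_mult[of "K * h"] using st by (intro mult_left_mono) auto
      then have y: "\<bar>K * h * (2 - s - t)\<bar> \<le> \<bar>2 * (K * h)\<bar>" by simp
      also have "\<dots> \<le> 1" using h by (simp add: abs_mult)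
      finally have "- (K * h * (2 - s - t)) \<le> 1" by linarith
      then have "exp (- (K * h * (2 - s - t))) \<le> 1 - K * h * (2 - s - t) + (K * h * (2 - s - t))\<^sup>2"
        using exp_le_quadratic[of "- (K * h * (2 - s - t))"] by simp
      also have "(K * h * (2 - s - t))\<^sup>2 \<le> (2 * (K * h))\<^sup>2"
        using y by (simp only: abs_le_square_iff)
      finally have "exp (- (K * h * (2 - s - t))) \<le> 1 - K * h * (2 - s - t) + 4 * K\<^sup>2 * h\<^sup>2"
        by (simp add: power_mult_distrib)
      then show ?thesis
        using w e by (intro mult_mono mult_right_mono) auto
    qed
    also have "exp (K * \<tau>) * a\<^sup>2 * (\<tau> / expint K \<tau>) = w * a\<^sup>2" by (simp add: w_def)
    finally have "w * a\<^sup>2 \<le> (1 + e) * ((1 - K * h * (2 - s - t) + 4 * K\<^sup>2 * h\<^sup>2) * L\<^sup>2 * (t - s)\<^sup>2)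
        + 2 * (E z' - E z) * \<tau>" by simp
    moreover have "(1 - e) * a\<^sup>2 \<le> w * a\<^sup>2" using w by (intro mult_right_mono) auto
    moreover have "(1 + e) * ((1 - K * h * (2 - s - t) + 4 * K\<^sup>2 * h\<^sup>2) * L\<^sup>2 * (t - s)\<^sup>2)
        + 2 * (E z' - E z) * \<tau>
      = (t - s) * ((1 + e) * L\<^sup>2 * (drift h t - drift h s) + 2 * h * (E z' - E z))"
      unfolding drift_diff \<tau>_def power2_eq_square[of "t - s"] by (simp add: ac_simps distrib_left)
    ultimately show ?thesis by (simp add: a_def)
  qed
qed

end

subsection \<open>Evolution of arcs and chains\<close>

text \<open>The weight \<open>c\<close> will be the target cost. Summed over the whole path, the
  first term then contributes \<open>c / 2\<close> and the second at most
  \<open>c / 2\<close>.\<close>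

lemma am_gm_control:
  fixes a c k l D :: real
  assumes "0 < c" "0 < k" "0 \<le> l" "0 \<le> D" "k * a\<^sup>2 \<le> l * D"
  shows "a \<le> (c * l + D / (c * k)) / 2"
proof -
  define q where "q = D / (c * k)"
  have q: "0 \<le> q" using assms by (simp add: q_def)
  have "a\<^sup>2 \<le> (c * l) * q"
    using assms by (simp add: q_def field_simps)
  also have "\<dots> \<le> ((c * l + q) / 2)\<^sup>2"
    using zero_le_power2[of "c * l - q"] by (simp add: power2_eq_square field_simps)
  finally have "a \<le> (c * l + q) / 2"
    by (rule power2_le_imp_le) (use q assms in simp)
  then show ?thesis by (simp add: q_def)
qed

text \<open>The counterpart of \<open>unit_arc\<close> for chains. The cost \<open>c\<close> is
  fixed before the mesh \<open>e\<close>, which builds in the supremum over meshes in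
  \<open>length_dist\<close>.\<close>

definition fine_chains :: "('a \<Rightarrow> 'a \<Rightarrow> ennreal) \<Rightarrow> real \<Rightarrow> 'a \<Rightarrow> 'a \<Rightarrow> bool" where
  "fine_chains d c y z \<longleftrightarrow> 0 \<le> c \<and> (\<forall>e>0. \<exists>N x. x 0 = y \<and> x N = z \<and>
     (\<forall>n<N. d (x n) (x (Suc n)) \<le> ennreal e) \<and> (\<Sum>n<N. d (x n) (x (Suc n))) \<le> ennreal c)"

context EVI_flow_on_space
begin

text \<open>The last hypothesis bounds the total increment of \<open>H\<close> by
  \<open>(1 - e) * c\<^sup>2\<close>, which makes \<open>R\<close> grow by at most \<open>c\<close>.
  The second conclusion is the monotonicity of \<open>H\<close> between the endpoints; it is kept
  because a square root of the limiting expression is taken later.\<close>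

lemma unit_arc_flow:
  assumes "unit_arc d L x y" and y: "y \<in> edom F" and h: "0 < h" "\<bar>K\<bar> * h \<le> 1/2"
    and e: "0 < e" "e < 1" and c: "0 < c"
    and le: "(1 + e) * L\<^sup>2 * drift h 1 + 2 * h * (E y - E (S h x)) \<le> (1 - e) * c\<^sup>2"
  shows "unit_arc d c (S h x) y"
    and "0 \<le> (1 + e) * L\<^sup>2 * drift h 1 + 2 * h * (E y - E (S h x))"
proof -
  obtain \<gamma> where L: "0 \<le> L" and \<gamma>: "\<gamma> 0 = x" "\<gamma> L = y"
    "\<And>s t. 0 \<le> s \<Longrightarrow> s \<le> t \<Longrightarrow> t \<le> L \<Longrightarrow> d (\<gamma> s) (\<gamma> t) \<le> ennreal (t - s)"
    using assms(1) unfolding unit_arc_def by blast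
  obtain \<delta> where \<delta>: "time_scale e \<delta>" using time_scale_exists[OF e(1)] .
  have "0 < \<delta>" using \<delta> by (simp add: time_scale_def)
  define z where "z = (\<lambda>s. S (h * (1 - s)) (\<gamma> (L * s)))"
  \<comment> \<open>The energy alone may decrease along the curve. Adding the drift gives a
    nondecreasing function, because the squared distance in the estimate for neighbouring points is
    nonnegative.\<close>
  define H where "H = (\<lambda>s. (1 + e) * L\<^sup>2 * drift h s + 2 * h * E (z s))"
  define R where "R = (\<lambda>s. (c * s + H s / (c * (1 - e))) / 2)"
  have H_diff: "H t - H s = (1 + e) * L\<^sup>2 * (drift h t - drift h s) + 2 * h * (E (z t) - E (z s))" for s t
    by (simp add: H_def algebra_simps)
  \<comment> \<open>Half of the admissible length, so that the excess time
    \<open>h * (t - s)\<close> stays strictly below \<delta>.\<close>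
  define m where "m = \<delta> / (2 * h)"
  have "0 < m" using \<open>0 < \<delta>\<close> h by (simp add: m_def)
  have z01: "z 0 = S h x" "z 1 = y" using \<gamma> by (simp_all add: z_def)
  have pair: "d (z s) (z t) < \<infinity>" "(1 - e) * (enn2real (d (z s) (z t)))\<^sup>2 \<le> (t - s) * (H t - H s)"
    if st: "0 \<le> s" "s \<le> t" "t \<le> 1" "t - s \<le> m" for s t
  proof -
    have "d (\<gamma> (L * s)) (\<gamma> (L * t)) \<le> ennreal (L * (t - s))"
      using \<gamma>(3)[of "L * s" "L * t"] st L
      by (simp add: right_diff_distrib mult_left_mono mult_left_le)
    \<comment> \<open>For \<open>t < 1\<close> the flow runs for a positive time and produces finite
      energy; for \<open>t = 1\<close> the point is \<open>y\<close>.\<close>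
    moreover have "S (h * (1 - t)) (\<gamma> (L * t)) \<in> edom F"
      using S_edom[of "h * (1 - t)"] h y \<gamma>(2) st by (cases "t = 1") auto
    moreover have "h * (t - s) < \<delta>"
    proof -
      have "h * (t - s) \<le> h * m" using st h by (intro mult_left_mono) auto
      also have "\<dots> < \<delta>" using h \<open>0 < \<delta>\<close> by (simp add: m_def)
      finally show ?thesis .
    qed
    ultimately show "d (z s) (z t) < \<infinity>"
      "(1 - e) * (enn2real (d (z s) (z t)))\<^sup>2 \<le> (t - s) * (H t - H s)"
      using pair_estimate[OF st(1,2,3) h L _ _ e \<delta>, of "\<gamma> (L * s)" "\<gamma> (L * t)"]
      unfolding H_diff z_def by blast+
  qed
  have H_local: "H s \<le> H t" if st: "0 \<le> s" "s \<le> t" "t \<le> 1" "t - s \<le> m" for s t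
  proof (cases "s = t")
    case False
    have "0 \<le> (1 - e) * (enn2real (d (z s) (z t)))\<^sup>2" using e by simp
    also have "\<dots> \<le> (t - s) * (H t - H s)" by (rule pair(2)[OF st])
    finally show ?thesis using False st by (simp add: zero_le_mult_iff)
  qed simp
  have H_mono: "H s \<le> H t" if "0 \<le> s" "s \<le> t" "t \<le> 1" for s t
    using \<open>0 < m\<close> H_local _ that
    by (rule local_to_global_on_interval[where r = "\<lambda>s t. H s \<le> H t"]) auto
  have H01: "H 1 - H 0 = (1 + e) * L\<^sup>2 * drift h 1 + 2 * h * (E y - E (S h x))"
    by (simp add: H_def z01 right_diff_distrib)
  show "0 \<le> (1 + e) * L\<^sup>2 * drift h 1 + 2 * h * (E y - E (S h x))"
    using H_mono[of 0 1] H01 by simp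
  have R_mono: "R s \<le> R t" if "0 \<le> s" "s \<le> t" "t \<le> 1" for s t
    unfolding R_def using that H_mono[OF that] c e
    by (intro divide_right_mono add_mono mult_left_mono) auto
  have R_local: "d (z s) (z t) \<le> ennreal (R t - R s)"
    if st: "0 \<le> s" "s \<le> t" "t \<le> 1" "t - s \<le> m" for s t
  proof -
    have "enn2real (d (z s) (z t)) \<le> (c * (t - s) + (H t - H s) / (c * (1 - e))) / 2"
      using c e st H_local[OF st] pair(2)[OF st] by (intro am_gm_control) auto
    also have "\<dots> = R t - R s"
      by (simp add: R_def right_diff_distrib diff_divide_distrib add_divide_distrib)
    finally show ?thesis using pair(1)[OF st] by (metis ennreal_enn2real ennreal_leI infinity_ennreal_def)
  qed
  have R_dist: "d (z s) (z t) \<le> ennreal (R t - R s)" if st: "0 \<le> s" "s \<le> t" "t \<le> 1" for s t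
    using \<open>0 < m\<close> R_local _ st
  proof (rule local_to_global_on_interval[where r = "\<lambda>s t. d (z s) (z t) \<le> ennreal (R t - R s)"])
    fix s t u :: real assume stu: "0 \<le> s" "s \<le> t" "t \<le> u" "u \<le> 1"
      and 1: "d (z s) (z t) \<le> ennreal (R t - R s)" and 2: "d (z t) (z u) \<le> ennreal (R u - R t)"
    have "d (z s) (z u) \<le> d (z s) (z t) + d (z t) (z u)" by (rule ext_metric_triangle[OF metric])
    also have "\<dots> \<le> ennreal (R t - R s) + ennreal (R u - R t)" by (rule add_mono[OF 1 2])
    also have "\<dots> = ennreal (R u - R s)"
      using R_mono[of s t] R_mono[of t u] stu by (simp flip: ennreal_plus)
    finally show "d (z s) (z u) \<le> ennreal (R u - R s)" .
  qed
  \<comment> \<open>\<open>R\<close> may jump with the energy, so it yields no continuity. The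
    product estimate does: with the increment of \<open>H\<close> at most
    \<open>(1 - e) * c\<^sup>2\<close> it bounds the squared distance by
    \<open>(t - s) * c\<^sup>2\<close>.\<close>
  have z_local: "d (z s) (z t) \<le> ennreal b"
    if st: "0 \<le> s" "s \<le> t" "t \<le> 1" "t - s \<le> m" and b: "0 < b" "(t - s) * c\<^sup>2 \<le> b\<^sup>2" for s t b
  proof -
    have "(1 - e) * (enn2real (d (z s) (z t)))\<^sup>2 \<le> (t - s) * (H t - H s)" by (rule pair(2)[OF st])
    also have "\<dots> \<le> (t - s) * ((1 - e) * c\<^sup>2)"
      using H_mono[of 0 s] H_mono[of t 1] H01 le st by (intro mult_left_mono) auto
    also have "\<dots> \<le> (1 - e) * b\<^sup>2"
      using mult_left_mono[OF b(2), of "1 - e"] e by (simp add: mult.left_commute)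
    finally have "(enn2real (d (z s) (z t)))\<^sup>2 \<le> b\<^sup>2" using e by simp
    then have "enn2real (d (z s) (z t)) \<le> b"
      by (rule power2_le_imp_le) (use b in simp)
    then show ?thesis
      using pair(1)[OF st] by (metis ennreal_enn2real ennreal_leI infinity_ennreal_def)
  qed
  have "unit_arc d c (z 0) (z 1)"
  proof (rule unit_arc_of_control[OF metric, of 0 1 R z c])
    fix t b :: real assume t: "t \<in> {0..1}" and "0 < b"
    define r where "r = min m (b\<^sup>2 / c\<^sup>2)"
    have r: "0 < r" using \<open>0 < m\<close> \<open>0 < b\<close> c by (simp add: r_def)
    have r': "l * c\<^sup>2 \<le> b\<^sup>2" "l \<le> m" if "l < r" for l
      using that c by (auto simp: r_def field_simps)
    have "d (z s) (z t) \<le> ennreal b" if s: "s \<in> {0..1}" "\<bar>s - t\<bar> < r" for s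
    proof (cases "s \<le> t")
      case True
      then show ?thesis using s t \<open>0 < b\<close> r'[of "t - s"] by (intro z_local) auto
    next
      case False
      then have "d (z t) (z s) \<le> ennreal b"
        using s t \<open>0 < b\<close> r'[of "s - t"] by (intro z_local) auto
      then show ?thesis by (simp add: ext_metric_sym[OF metric])
    qed
    with r show "\<exists>r>0. \<forall>s\<in>{0..1}. \<bar>s - t\<bar> < r \<longrightarrow> d (z s) (z t) \<le> ennreal b" by blast
  next
    define Q where "Q = (H 1 - H 0) / (c * (1 - e))"
    have "Q \<le> c" unfolding Q_def
      using le c e unfolding H01[symmetric] by (simp add: field_simps power2_eq_square)
    moreover have "R 1 - R 0 = (c + Q) / 2"
      by (simp add: R_def Q_def diff_divide_distrib add_divide_distrib)
    ultimately show "R 1 - R 0 \<le> c" by simp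
  qed (use R_mono R_dist in auto)
  with z01 show "unit_arc d c (S h x) y" by simp
qed

end

text \<open>A discrete arc-length parametrisation by \<open>[0, 1]\<close> with small parameter
  steps. It must also handle chains shorter than \<open>L\<close> and the case \<open>L = 0\<close>,
  where arc length alone does not reach parameter 1.\<close>

lemma fine_chains_parametrized:
  assumes d: "ext_metric d" and fc: "fine_chains d L y z" and "0 < m"
  obtains N x t where "t 0 = (0::real)" "t N = 1" "x 0 = y" "x N = z"
    "\<And>n. n < N \<Longrightarrow> t n \<le> t (Suc n)" "\<And>n. n < N \<Longrightarrow> t (Suc n) - t n \<le> m"
    "\<And>n. n < N \<Longrightarrow> d (x n) (x (Suc n)) \<le> ennreal (L * (t (Suc n) - t n))"
proof -
  have L: "0 \<le> L" using fc by (simp add: fine_chains_def)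
  \<comment> \<open>Links of length at most \<open>L * m / 2\<close> use at most
    \<open>m / 2\<close> of the parameter each. For \<open>L = 0\<close> all links vanish and any
    mesh will do.\<close>
  define e where "e = (if L = 0 then 1 else L * m / 2)"
  have "0 < e" using L \<open>0 < m\<close> by (simp add: e_def)
  obtain N x where x: "x 0 = y" "x N = z" "\<And>n. n < N \<Longrightarrow> d (x n) (x (Suc n)) \<le> ennreal e"
    "(\<Sum>n<N. d (x n) (x (Suc n))) \<le> ennreal L"
    using fc \<open>0 < e\<close> unfolding fine_chains_def by blast
  obtain M :: nat where M: "2 / m < real M" using reals_Archimedean2 by blast
  have "0 < M" using M \<open>0 < m\<close> by (metis divide_pos_pos less_trans of_nat_0_less_iff zero_less_numeral)
  \<comment> \<open>The chain is prolonged by \<open>M\<close> copies of its last point, so that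
    equal steps \<open>1 / N'\<close> are at most \<open>m / 2\<close>.\<close>
  define N' where "N' = N + M"
  have N': "0 < N'" "1 / real N' \<le> m / 2"
  proof -
    show "0 < N'" using \<open>0 < M\<close> by (simp add: N'_def)
    have "1 / real N' \<le> 1 / real M" using \<open>0 < M\<close> by (intro divide_left_mono) (auto simp: N'_def)
    also have "\<dots> \<le> m / 2" using M \<open>0 < m\<close> \<open>0 < M\<close> by (simp add: field_simps)
    finally show "1 / real N' \<le> m / 2" .
  qed
  define x' where "x' = (\<lambda>n. x (min n N))"
  define l where "l = (\<lambda>n. enn2real (d (x' n) (x' (Suc n))))"
  have x'_lt: "x' n = x n" "x' (Suc n) = x (Suc n)" if "n < N" for n
    using that by (simp_all add: x'_def min_def)
  have x'_ge: "d (x' n) (x' (Suc n)) = 0" if "\<not> n < N" for n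
    using that by (simp add: x'_def min_def ext_metric_refl[OF d])
  have le_e: "d (x' n) (x' (Suc n)) \<le> ennreal e" for n
    using x(3)[of n] x'_lt[of n] x'_ge[of n] by (cases "n < N") auto
  have l: "0 \<le> l n" "d (x' n) (x' (Suc n)) = ennreal (l n)" "l n \<le> e" for n
  proof -
    have "d (x' n) (x' (Suc n)) < top" using le_e[of n] by (rule le_less_trans) simp
    then show "d (x' n) (x' (Suc n)) = ennreal (l n)" by (simp add: l_def)
    show "l n \<le> e" unfolding l_def using le_e[of n] \<open>0 < e\<close> by (intro enn2real_leI) auto
  qed (simp add: l_def)
  define \<Lambda> where "\<Lambda> = (\<Sum>n<N'. l n)"
  have "ennreal \<Lambda> = (\<Sum>n<N'. d (x' n) (x' (Suc n)))"
    unfolding \<Lambda>_def using l by (simp add: sum_ennreal)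
  also have "\<dots> = (\<Sum>n<N. d (x n) (x (Suc n)))"
    using x'_lt x'_ge by (intro sum.mono_neutral_cong_right) (auto simp: N'_def)
  also have "\<dots> \<le> ennreal L" by (rule x(4))
  finally have \<Lambda>: "\<Lambda> \<le> L" "0 \<le> \<Lambda>"
    using L l by (auto simp: \<Lambda>_def sum_nonneg)
  define \<kappa> where "\<kappa> = 1 - \<Lambda> / L"
  have \<kappa>: "0 \<le> \<kappa>" "\<kappa> \<le> 1" using \<Lambda> L by (auto simp: \<kappa>_def divide_le_eq_1)
  define t where "t = (\<lambda>n. (\<Sum>k<n. l k) / L + \<kappa> * (real n / real N'))"
  have t_diff: "t (Suc n) - t n = l n / L + \<kappa> * (1 / real N')" for n
    by (simp add: t_def add_divide_distrib algebra_simps)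
  have l_L: "l n / L \<le> m / 2" for n
    using l(3)[of n] L \<open>0 < m\<close> by (cases "L = 0") (auto simp: e_def field_simps)
  show thesis
  proof (rule that[of t N' x'])
    show "t 0 = 0" by (simp add: t_def)
    show "t N' = 1" using N' by (simp add: t_def \<kappa>_def \<Lambda>_def)
    show "x' 0 = y" "x' N' = z" using x by (simp_all add: x'_def N'_def)
    fix n assume "n < N'"
    have "0 \<le> l n / L" "0 \<le> \<kappa> * (1 / real N')" using l(1) L \<kappa> by simp_all
    then show "t n \<le> t (Suc n)" using t_diff[of n] by linarith
    have "\<kappa> * (1 / real N') \<le> 1 * (1 / real N')" using \<kappa> by (intro mult_right_mono) auto
    then show "t (Suc n) - t n \<le> m" using t_diff[of n] l_L[of n] N' by linarith
    have "l n \<le> L * (t (Suc n) - t n)"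
    proof (cases "L = 0")
      case True
      have "l n \<le> \<Lambda>" unfolding \<Lambda>_def using \<open>n < N'\<close> l by (intro member_le_sum) auto
      with True \<Lambda> show ?thesis by simp
    next
      case False
      then have "L * (t (Suc n) - t n) = l n + L * (\<kappa> * (1 / real N'))"
        by (simp add: t_diff distrib_left)
      then show ?thesis using L \<kappa> by simp
    qed
    then show "d (x' n) (x' (Suc n)) \<le> ennreal (L * (t (Suc n) - t n))"
      by (simp add: l(2) ennreal_leI)
  qed
qed

context EVI_flow_on_space
begin

lemma fine_chains_flow:
  assumes fc: "fine_chains d L x y" and y: "y \<in> edom F" and h: "0 < h" "\<bar>K\<bar> * h \<le> 1/2"
    and e: "0 < e" "e < 1" and c: "0 < c"
    and le: "(1 + e) * L\<^sup>2 * drift h 1 + 2 * h * (E y - E (S h x)) \<le> (1 - e) * c\<^sup>2"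
  shows "fine_chains d c (S h x) y"
    and "0 \<le> (1 + e) * L\<^sup>2 * drift h 1 + 2 * h * (E y - E (S h x))"
proof -
  have L: "0 \<le> L" using fc by (simp add: fine_chains_def)
  obtain \<delta> where \<delta>: "time_scale e \<delta>" using time_scale_exists[OF e(1)] .
  have "0 < \<delta>" using \<delta> by (simp add: time_scale_def)
  have main: "(\<exists>N z. z 0 = S h x \<and> z N = y \<and> (\<forall>n<N. d (z n) (z (Suc n)) \<le> ennreal b) \<and>
      (\<Sum>n<N. d (z n) (z (Suc n))) \<le> ennreal c) \<and>
      0 \<le> (1 + e) * L\<^sup>2 * drift h 1 + 2 * h * (E y - E (S h x))" if "0 < b" for b
  proof -
    \<comment> \<open>The first bound keeps the excess times below \<delta>; the second makes each
      new link at most \<open>b\<close>, since its square is at most the parameter step times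
      \<open>c\<^sup>2\<close>.\<close>
    define m where "m = min (\<delta> / (2 * h)) (b\<^sup>2 / c\<^sup>2)"
    have "0 < m" using \<open>0 < \<delta>\<close> \<open>0 < b\<close> h c by (simp add: m_def)
    obtain N p t where t01: "t 0 = (0::real)" "t N = 1" and p: "p 0 = x" "p N = y"
      and t_step: "\<And>n. n < N \<Longrightarrow> t n \<le> t (Suc n)" "\<And>n. n < N \<Longrightarrow> t (Suc n) - t n \<le> m"
      and p_step: "\<And>n. n < N \<Longrightarrow> d (p n) (p (Suc n)) \<le> ennreal (L * (t (Suc n) - t n))"
      using fine_chains_parametrized[OF metric fc \<open>0 < m\<close>] by metis
    have t_mono: "t i \<le> t j" if "i \<le> j" "j \<le> N" for i j
      using that by (induction j rule: dec_induct) (auto intro: order_trans[OF _ t_step(1)])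
    have t_in: "0 \<le> t n" "t n \<le> 1" if "n \<le> N" for n
      using t_mono[of 0 n] t_mono[of n N] that t01 by auto
    \<comment> \<open>The parameter may reach 1 before the last vertex. The vertices from there on
      coincide with \<open>y\<close>, so no other point is left unflowed and all energies are
      finite.\<close>
    have p_end: "p n = y" if "n \<le> N" "t n = 1" for n
      using that
    proof (induction n rule: inc_induct)
      case base
      show ?case by (rule p(2))
    next
      case (step n)
      then have t1: "t (Suc n) = 1" using t_step(1)[of n] t_in[of "Suc n"] by simp
      then have "d (p n) (p (Suc n)) = 0" using p_step[of n] step by simp
      then show ?case using step t1 by (simp add: ext_metric_zero_iff[OF metric])
    qed
    define z where "z = (\<lambda>n. S (h * (1 - t n)) (p n))"
    define H where "H = (\<lambda>n. (1 + e) * L\<^sup>2 * drift h (t n) + 2 * h * E (z n))"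
    have H_diff: "H n - H k = (1 + e) * L\<^sup>2 * (drift h (t n) - drift h (t k))
        + 2 * h * (E (z n) - E (z k))" for n k
      by (simp add: H_def algebra_simps)
    define R where "R = (\<lambda>n. (c * t n + H n / (c * (1 - e))) / 2)"
    have z01: "z 0 = S h x" "z N = y" using p t01 by (simp_all add: z_def)
    have z_dom: "z n \<in> edom F" if "n \<le> N" for n
      using S_edom[of "h * (1 - t n)" "p n"] t_in[OF that] h p_end[OF that] y
      by (cases "t n = 1") (auto simp: z_def)
    have pair: "d (z n) (z (Suc n)) < \<infinity>"
      "(1 - e) * (enn2real (d (z n) (z (Suc n))))\<^sup>2 \<le> (t (Suc n) - t n) * (H (Suc n) - H n)"
      if n: "n < N" for n
    proof -
      have "h * (t (Suc n) - t n) \<le> h * (\<delta> / (2 * h))"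
        using t_step(2)[OF n] h by (intro mult_left_mono) (auto simp: m_def)
      also have "\<dots> < \<delta>" using h \<open>0 < \<delta>\<close> by simp
      finally have "h * (t (Suc n) - t n) < \<delta>" .
      then show "d (z n) (z (Suc n)) < \<infinity>"
        "(1 - e) * (enn2real (d (z n) (z (Suc n))))\<^sup>2 \<le> (t (Suc n) - t n) * (H (Suc n) - H n)"
        using pair_estimate[OF t_in(1) t_step(1)[OF n] t_in(2) h L p_step[OF n] _ e \<delta>]
          z_dom[of "Suc n"] n
        unfolding H_diff z_def by simp_all
    qed
    have H_step: "H n \<le> H (Suc n)" if n: "n < N" for n
    proof (cases "t n = t (Suc n)")
      case False
      have "0 \<le> (1 - e) * (enn2real (d (z n) (z (Suc n))))\<^sup>2" using e by simp
      also have "\<dots> \<le> (t (Suc n) - t n) * (H (Suc n) - H n)" by (rule pair(2)[OF n])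
      finally show ?thesis using False t_step(1)[OF n] by (simp add: zero_le_mult_iff)
    next
      \<comment> \<open>The product estimate is empty for a vanishing parameter step; but then the
        two vertices coincide.\<close>
      case True
      then have "d (p n) (p (Suc n)) = 0" using p_step[OF n] by simp
      then have "p n = p (Suc n)" by (simp add: ext_metric_zero_iff[OF metric])
      with True show ?thesis by (simp add: H_def z_def)
    qed
    have H_mono: "H i \<le> H j" if "i \<le> j" "j \<le> N" for i j
      using that by (induction j rule: dec_induct) (auto intro: order_trans[OF _ H_step])
    have H01: "H N - H 0 = (1 + e) * L\<^sup>2 * drift h 1 + 2 * h * (E y - E (S h x))"
      by (simp add: H_def z01 t01 right_diff_distrib)
    have nonneg: "0 \<le> (1 + e) * L\<^sup>2 * drift h 1 + 2 * h * (E y - E (S h x))"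
      using H_mono[of 0 N] H01 by simp
    have R_step: "R n \<le> R (Suc n)" if "n < N" for n
      unfolding R_def using H_step[OF that] t_step(1)[OF that] c e
      by (intro divide_right_mono add_mono mult_left_mono) auto
    have R_dist: "d (z n) (z (Suc n)) \<le> ennreal (R (Suc n) - R n)" if n: "n < N" for n
    proof -
      have "enn2real (d (z n) (z (Suc n)))
          \<le> (c * (t (Suc n) - t n) + (H (Suc n) - H n) / (c * (1 - e))) / 2"
        using c e t_step(1)[OF n] H_step[OF n] pair(2)[OF n] by (intro am_gm_control) auto
      also have "\<dots> = R (Suc n) - R n"
        by (simp add: R_def right_diff_distrib diff_divide_distrib add_divide_distrib)
      finally show ?thesis
        using pair(1)[OF n] by (metis ennreal_enn2real ennreal_leI infinity_ennreal_def)
    qed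
    have "(\<Sum>n<N. d (z n) (z (Suc n))) \<le> (\<Sum>n<N. ennreal (R (Suc n) - R n))"
      using R_dist by (intro sum_mono) auto
    also have "\<dots> = ennreal (\<Sum>n<N. R (Suc n) - R n)"
      using R_step by (intro sum_ennreal) auto
    also have "(\<Sum>n<N. R (Suc n) - R n) = R N - R 0" by (rule sum_lessThan_telescope)
    also have "R N - R 0 \<le> c"
    proof -
      define Q where "Q = (H N - H 0) / (c * (1 - e))"
      have "Q \<le> c" unfolding Q_def
        using le c e unfolding H01[symmetric] by (simp add: field_simps power2_eq_square)
      moreover have "R N - R 0 = (c + Q) / 2"
        by (simp add: R_def Q_def t01 diff_divide_distrib add_divide_distrib)
      ultimately show ?thesis by simp
    qed
    finally have len: "(\<Sum>n<N. d (z n) (z (Suc n))) \<le> ennreal c" by (simp add: ennreal_leI)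
    have "d (z n) (z (Suc n)) \<le> ennreal b" if n: "n < N" for n
    proof -
      have "(1 - e) * (enn2real (d (z n) (z (Suc n))))\<^sup>2 \<le> (t (Suc n) - t n) * (H (Suc n) - H n)"
        by (rule pair(2)[OF n])
      also have "\<dots> \<le> (b\<^sup>2 / c\<^sup>2) * ((1 - e) * c\<^sup>2)"
        using H_mono[of 0 n] H_mono[of "Suc n" N] H_step[OF n] H01 le n t_step[OF n]
        by (intro mult_mono) (auto simp: m_def)
      also have "\<dots> = (1 - e) * b\<^sup>2" using c by simp
      finally have "(enn2real (d (z n) (z (Suc n))))\<^sup>2 \<le> b\<^sup>2" using e by simp
      then have "enn2real (d (z n) (z (Suc n))) \<le> b"
        by (rule power2_le_imp_le) (use \<open>0 < b\<close> in simp)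
      then show ?thesis
        using pair(1)[OF n] by (metis ennreal_enn2real ennreal_leI infinity_ennreal_def)
    qed
    with z01 len nonneg show ?thesis by blast
  qed
  show "fine_chains d c (S h x) y"
    unfolding fine_chains_def using main c by simp
  show "0 \<le> (1 + e) * L\<^sup>2 * drift h 1 + 2 * h * (E y - E (S h x))"
    using main[of 1] by simp
qed

end

subsection \<open>The chain distance\<close>

lemma fine_chains_sym:
  assumes d: "ext_metric d" and fc: "fine_chains d c y z"
  shows "fine_chains d c z y"
  unfolding fine_chains_def
proof (intro conjI allI impI)
  show "0 \<le> c" using fc by (simp add: fine_chains_def)
  fix e :: real assume "0 < e"
  then obtain N x where x: "x 0 = y" "x N = z" "\<And>n. n < N \<Longrightarrow> d (x n) (x (Suc n)) \<le> ennreal e"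
    "(\<Sum>n<N. d (x n) (x (Suc n))) \<le> ennreal c"
    using fc unfolding fine_chains_def by blast
  have rev: "d (x (N - n)) (x (N - Suc n)) = d (x (N - Suc n)) (x (Suc (N - Suc n)))" if "n < N" for n
    using that by (simp add: Suc_diff_Suc ext_metric_sym[OF d, of "x (N - n)"])
  have "(\<Sum>n<N. d (x (N - n)) (x (N - Suc n))) = (\<Sum>n<N. d (x (N - Suc n)) (x (Suc (N - Suc n))))"
    using rev by (intro sum.cong) auto
  also have "\<dots> = (\<Sum>n<N. d (x n) (x (Suc n)))"
    by (rule sum.nat_diff_reindex[where g = "\<lambda>n. d (x n) (x (Suc n))"])
  finally have "(\<Sum>n<N. d (x (N - n)) (x (N - Suc n))) \<le> ennreal c" using x(4) by simp
  moreover have "d (x (N - n)) (x (N - Suc n)) \<le> ennreal e" if "n < N" for n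
    unfolding rev[OF that] using that by (intro x(3)) simp
  ultimately show "\<exists>N x. x 0 = z \<and> x N = y \<and> (\<forall>n<N. d (x n) (x (Suc n)) \<le> ennreal e) \<and>
      (\<Sum>n<N. d (x n) (x (Suc n))) \<le> ennreal c"
    using x(1,2) by (intro exI[of _ N] exI[of _ "\<lambda>n. x (N - n)"]) simp
qed

lemma fine_chains_trans:
  assumes fc1: "fine_chains d c1 x y" and fc2: "fine_chains d c2 y z"
  shows "fine_chains d (c1 + c2) x z"
  unfolding fine_chains_def
proof (intro conjI allI impI)
  have c: "0 \<le> c1" "0 \<le> c2" using fc1 fc2 by (simp_all add: fine_chains_def)
  then show "0 \<le> c1 + c2" by simp
  fix e :: real assume "0 < e"
  obtain N1 x1 where x1: "x1 0 = x" "x1 N1 = y" "\<And>n. n < N1 \<Longrightarrow> d (x1 n) (x1 (Suc n)) \<le> ennreal e"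
    "(\<Sum>n<N1. d (x1 n) (x1 (Suc n))) \<le> ennreal c1"
    using fc1 \<open>0 < e\<close> unfolding fine_chains_def by blast
  obtain N2 x2 where x2: "x2 0 = y" "x2 N2 = z" "\<And>n. n < N2 \<Longrightarrow> d (x2 n) (x2 (Suc n)) \<le> ennreal e"
    "(\<Sum>n<N2. d (x2 n) (x2 (Suc n))) \<le> ennreal c2"
    using fc2 \<open>0 < e\<close> unfolding fine_chains_def by blast
  define p where "p = (\<lambda>n. if n < N1 then x1 n else x2 (n - N1))"
  have p1: "d (p n) (p (Suc n)) = d (x1 n) (x1 (Suc n))" if "n < N1" for n
    using that x1(2) x2(1) by (cases "Suc n = N1") (auto simp: p_def)
  have p2: "p (N1 + n) = x2 n" for n by (simp add: p_def)
  have split: "(\<Sum>n<N1 + N2. f n) = (\<Sum>n<N1. f n) + (\<Sum>n<N2. f (N1 + n))" for f :: "nat \<Rightarrow> ennreal"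
    by (induction N2) (auto simp: add.assoc)
  have "(\<Sum>n<N1 + N2. d (p n) (p (Suc n)))
      = (\<Sum>n<N1. d (x1 n) (x1 (Suc n))) + (\<Sum>n<N2. d (x2 n) (x2 (Suc n)))"
    unfolding split using p1 p2 by (simp flip: add_Suc_right)
  also have "\<dots> \<le> ennreal c1 + ennreal c2" by (rule add_mono[OF x1(4) x2(4)])
  also have "\<dots> = ennreal (c1 + c2)" using c by simp
  finally have "(\<Sum>n<N1 + N2. d (p n) (p (Suc n))) \<le> ennreal (c1 + c2)" .
  moreover have "d (p n) (p (Suc n)) \<le> ennreal e" if "n < N1 + N2" for n
  proof (cases "n < N1")
    case True
    then show ?thesis using p1 x1(3) by simp
  next
    case False
    then obtain k where "n = N1 + k" using le_Suc_ex not_less by blast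
    with that show ?thesis using p2[of k] p2[of "Suc k"] x2(3)[of k] by simp
  qed
  moreover have "p 0 = x" using x1(1,2) x2(1) by (cases "N1 = 0") (auto simp: p_def)
  moreover have "p (N1 + N2) = z" using p2 x2(2) by simp
  ultimately show "\<exists>N p. p 0 = x \<and> p N = z \<and> (\<forall>n<N. d (p n) (p (Suc n)) \<le> ennreal e) \<and>
      (\<Sum>n<N. d (p n) (p (Suc n))) \<le> ennreal (c1 + c2)" by blast
qed

lemma fine_chains_lipschitz_image:
  assumes "0 < l" and f: "\<And>x y. d (f x) (f y) \<le> ennreal l * d x y" and fc: "fine_chains d c y z"
  shows "fine_chains d (l * c) (f y) (f z)"
  unfolding fine_chains_def
proof (intro conjI allI impI)
  have c: "0 \<le> c" using fc by (simp add: fine_chains_def)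
  then show "0 \<le> l * c" using \<open>0 < l\<close> by simp
  fix e :: real assume "0 < e"
  then have "0 < e / l" using \<open>0 < l\<close> by simp
  then obtain N x where x: "x 0 = y" "x N = z" "\<And>n. n < N \<Longrightarrow> d (x n) (x (Suc n)) \<le> ennreal (e / l)"
    "(\<Sum>n<N. d (x n) (x (Suc n))) \<le> ennreal c"
    using fc unfolding fine_chains_def by blast
  have "(\<Sum>n<N. d (f (x n)) (f (x (Suc n)))) \<le> (\<Sum>n<N. ennreal l * d (x n) (x (Suc n)))"
    using f by (intro sum_mono) auto
  also have "\<dots> \<le> ennreal l * ennreal c"
    unfolding sum_distrib_left[symmetric] by (rule mult_left_mono[OF x(4)]) simp
  also have "\<dots> = ennreal (l * c)" using c \<open>0 < l\<close> by (simp add: ennreal_mult)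
  finally have "(\<Sum>n<N. d (f (x n)) (f (x (Suc n)))) \<le> ennreal (l * c)" .
  moreover have "d (f (x n)) (f (x (Suc n))) \<le> ennreal e" if "n < N" for n
  proof -
    have "d (f (x n)) (f (x (Suc n))) \<le> ennreal l * ennreal (e / l)"
      using f x(3)[OF that] by (meson mult_left_mono order_trans zero_le)
    also have "\<dots> = ennreal e" using \<open>0 < l\<close> \<open>0 < e\<close> by (simp flip: ennreal_mult)
    finally show ?thesis .
  qed
  ultimately show "\<exists>N p. p 0 = f y \<and> p N = f z \<and> (\<forall>n<N. d (p n) (p (Suc n)) \<le> ennreal e) \<and>
      (\<Sum>n<N. d (p n) (p (Suc n))) \<le> ennreal (l * c)"
    using x(1,2) by (intro exI[of _ N] exI[of _ "\<lambda>n. f (x n)"]) simp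
qed

lemma fine_chains_of_unit_arc:
  assumes "unit_arc d c y z"
  shows "fine_chains d c y z"
  unfolding fine_chains_def
proof (intro conjI allI impI)
  obtain \<gamma> where c: "0 \<le> c" and \<gamma>: "\<gamma> 0 = y" "\<gamma> c = z"
    "\<And>s t. 0 \<le> s \<Longrightarrow> s \<le> t \<Longrightarrow> t \<le> c \<Longrightarrow> d (\<gamma> s) (\<gamma> t) \<le> ennreal (t - s)"
    using assms unfolding unit_arc_def by blast
  show "0 \<le> c" by (rule c)
  fix e :: real assume "0 < e"
  \<comment> \<open>The strict inequality also makes \<open>N\<close> positive when
    \<open>c = 0\<close>.\<close>
  obtain N :: nat where N: "c / e < real N" using reals_Archimedean2 by blast
  have "0 < real N" using N c \<open>0 < e\<close> by (meson divide_nonneg_pos le_less_trans)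
  then have N': "0 < N" "c / real N \<le> e" using N \<open>0 < e\<close> by (auto simp: field_simps)
  define x where "x = (\<lambda>n. \<gamma> (c * (real n / real N)))"
  have step: "d (x n) (x (Suc n)) \<le> ennreal (c / real N)" if "n < N" for n
  proof -
    have "d (x n) (x (Suc n)) \<le> ennreal (c * (real (Suc n) / real N) - c * (real n / real N))"
      unfolding x_def using that c N'(1)
      by (intro \<gamma>(3) mult_left_mono mult_left_le divide_right_mono) (auto simp: divide_le_eq_1)
    also have "c * (real (Suc n) / real N) - c * (real n / real N) = c / real N"
      by (simp add: add_divide_distrib distrib_left)
    finally show ?thesis .
  qed
  have "(\<Sum>n<N. d (x n) (x (Suc n))) \<le> (\<Sum>n<N. ennreal (c / real N))"
    using step by (intro sum_mono) auto
  also have "\<dots> = ennreal (\<Sum>n<N. c / real N)" using c by (intro sum_ennreal) simp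
  also have "(\<Sum>n<N. c / real N) = c" using N'(1) by simp
  finally have "(\<Sum>n<N. d (x n) (x (Suc n))) \<le> ennreal c" .
  moreover have "d (x n) (x (Suc n)) \<le> ennreal e" if "n < N" for n
    using step[OF that] N'(2) by (meson ennreal_leI order_trans)
  moreover have "x 0 = y" "x N = z" using \<gamma>(1,2) N'(1) by (simp_all add: x_def)
  ultimately show "\<exists>N x. x 0 = y \<and> x N = z \<and> (\<forall>n<N. d (x n) (x (Suc n)) \<le> ennreal e) \<and>
      (\<Sum>n<N. d (x n) (x (Suc n))) \<le> ennreal c" by blast
qed

lemma chain_dist_eq:
  assumes d: "ext_metric d"
  shows "chain_dist d e y z = Inf {\<Sum>n<N. d (x n) (x (Suc n)) | N x.
    x 0 = y \<and> x N = z \<and> (\<forall>n<N. d (x n) (x (Suc n)) \<le> ennreal e)}"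
proof -
  have "(\<Sum>n=1..N. d (x n) (x (n - 1))) = (\<Sum>n<N. d (x n) (x (Suc n)))" for N x
    by (simp add: sum.atLeast1_atMost_eq ext_metric_sym[OF d, of "x (Suc _)"])
  moreover have "(\<forall>n\<in>{1..N}. d (x (n - 1)) (x n) \<le> ennreal e)
      \<longleftrightarrow> (\<forall>n<N. d (x n) (x (Suc n)) \<le> ennreal e)" for N x
    unfolding One_nat_def by (metis Suc_le_eq Suc_pred atLeastAtMost_iff diff_Suc_1 zero_less_Suc)
  ultimately show ?thesis unfolding chain_dist_def by simp
qed

text \<open>The cost \<open>c\<close> exceeds the supremum over meshes, hence the infimum at every
  single mesh, so each mesh has a chain cheaper than \<open>c\<close>.\<close>

lemma fine_chains_of_length_dist_less:
  assumes d: "ext_metric d" and less: "length_dist d y z < ennreal c"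
  shows "fine_chains d c y z"
  unfolding fine_chains_def
proof (intro conjI allI impI)
  have "0 < ennreal c" using less by (rule le_less_trans[OF zero_le])
  then show "0 \<le> c" by simp
  fix e :: real assume "0 < e"
  then have "chain_dist d e y z \<le> length_dist d y z"
    unfolding length_dist_def by (intro SUP_upper) simp
  then have "chain_dist d e y z < ennreal c" using less by (rule le_less_trans)
  then show "\<exists>N x. x 0 = y \<and> x N = z \<and> (\<forall>n<N. d (x n) (x (Suc n)) \<le> ennreal e) \<and>
      (\<Sum>n<N. d (x n) (x (Suc n))) \<le> ennreal c"
    unfolding chain_dist_eq[OF d] Inf_less_iff by (blast intro: less_imp_le)
qed

lemma length_dist_le:
  assumes d: "ext_metric d" and fc: "fine_chains d c y z"
  shows "length_dist d y z \<le> ennreal c"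
  unfolding length_dist_def
proof (rule SUP_least)
  fix e :: real assume "e \<in> {0<..}"
  then obtain N x where x: "x 0 = y" "x N = z" "\<forall>n<N. d (x n) (x (Suc n)) \<le> ennreal e"
    "(\<Sum>n<N. d (x n) (x (Suc n))) \<le> ennreal c"
    using fc unfolding fine_chains_def by (metis greaterThan_iff)
  have "chain_dist d e y z \<le> (\<Sum>n<N. d (x n) (x (Suc n)))"
    unfolding chain_dist_eq[OF d] using x(1,2,3) by (intro Inf_lower) blast
  then show "chain_dist d e y z \<le> ennreal c" using x(4) by (rule order_trans)
qed

subsection \<open>Transfer of the flow\<close>

lemma ennreal_le_of_less_imp_le:
  assumes "\<And>c. a < ennreal c \<Longrightarrow> b \<le> ennreal c"
  shows "b \<le> a"
proof (cases a)
  case (real r)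
  show ?thesis
  proof (rule ennreal_le_epsilon)
    fix e :: real assume "0 < e"
    then show "b \<le> a + ennreal e"
      using assms[of "r + e"] real by (simp add: ennreal_less_iff)
  qed
qed simp

context EVI_flow_on_space
begin

text \<open>\<open>P c y z\<close> says that \<open>y\<close> and \<open>z\<close> are joined at cost \<open>c\<close>, by a curve or by arbitrarily fine
  chains.\<close>
context
  fixes d' :: "'a \<Rightarrow> 'a \<Rightarrow> ennreal" and P :: "real \<Rightarrow> 'a \<Rightarrow> 'a \<Rightarrow> bool"
  assumes P_less: "\<And>c y z. d' y z < ennreal c \<Longrightarrow> P c y z"
    and P_le: "\<And>c y z. P c y z \<Longrightarrow> d' y z \<le> ennreal c"
    and P_sym: "\<And>c y z. P c y z \<Longrightarrow> P c z y"
    and P_trans: "\<And>c1 c2 x y z. P c1 x y \<Longrightarrow> P c2 y z \<Longrightarrow> P (c1 + c2) x z"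
    and P_image: "\<And>t c y z. 0 \<le> t \<Longrightarrow> P c y z \<Longrightarrow> P (exp (- K * t) * c) (S t y) (S t z)"
    and P_arc: "\<And>c y z. unit_arc d c y z \<Longrightarrow> P c y z"
    and P_flow: "\<And>L x y h e c. P L x y \<Longrightarrow> y \<in> edom F \<Longrightarrow> 0 < h \<Longrightarrow> \<bar>K\<bar> * h \<le> 1/2 \<Longrightarrow>
      0 < e \<Longrightarrow> e < 1 \<Longrightarrow> 0 < c \<Longrightarrow>
      (1 + e) * L\<^sup>2 * drift h 1 + 2 * h * (E y - E (S h x)) \<le> (1 - e) * c\<^sup>2 \<Longrightarrow>
      P c (S h x) y \<and> 0 \<le> (1 + e) * L\<^sup>2 * drift h 1 + 2 * h * (E y - E (S h x))"
begin

section \<open>Metric properties of the new distance\<close>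

lemma d'_sym: "d' y z = d' z y"
proof -
  have le: "d' y z \<le> d' z y" for y z
    by (rule ennreal_le_of_less_imp_le) (rule P_le[OF P_sym[OF P_less]])
  show ?thesis by (rule antisym[OF le le])
qed

lemma d'_triangle: "d' x z \<le> d' x y + d' y z"
proof (cases "d' x y = \<infinity> \<or> d' y z = \<infinity>")
  case False
  then obtain A B where AB: "d' x y = ennreal A" "0 \<le> A" "d' y z = ennreal B" "0 \<le> B"
    by (metis ennreal_cases infinity_ennreal_def)
  show ?thesis
  proof (rule ennreal_le_epsilon)
    fix e :: real assume "0 < e"
    then have "P (A + e / 2) x y" "P (B + e / 2) y z"
      using AB by (auto intro!: P_less simp: ennreal_less_iff)
    then have "P ((A + e / 2) + (B + e / 2)) x z" by (rule P_trans)
    then have "d' x z \<le> ennreal ((A + e / 2) + (B + e / 2))" by (rule P_le)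
    then show "d' x z \<le> d' x y + d' y z + ennreal e"
      using AB \<open>0 < e\<close> by (simp add: algebra_simps flip: ennreal_plus)
  qed
qed auto

lemma d'_contraction:
  assumes "0 \<le> t"
  shows "d' (S t y) (S t z) \<le> ennreal (exp (- K * t)) * d' y z"
proof (cases "d' y z = \<infinity>")
  case True
  then show ?thesis by (simp add: ennreal_mult_top)
next
  case False
  then obtain A where A: "d' y z = ennreal A" "0 \<le> A"
    by (metis ennreal_cases infinity_ennreal_def)
  show ?thesis
  proof (rule ennreal_le_epsilon)
    fix e :: real assume "0 < e"
    define b where "b = e / exp (- K * t)"
    have "0 < b" using \<open>0 < e\<close> by (simp add: b_def)
    then have "P (A + b) y z" using A by (auto intro!: P_less simp: ennreal_less_iff)
    then have "d' (S t y) (S t z) \<le> ennreal (exp (- K * t) * (A + b))"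
      by (rule P_le[OF P_image[OF assms]])
    also have "exp (- K * t) * (A + b) = exp (- K * t) * A + e"
      by (simp add: b_def distrib_left)
    also have "ennreal \<dots> = ennreal (exp (- K * t)) * d' y z + ennreal e"
      using A \<open>0 < e\<close> by (simp add: ennreal_mult)
    finally show "d' (S t y) (S t z) \<le> ennreal (exp (- K * t)) * d' y z + ennreal e" .
  qed
qed

lemma d'_refl: "d' x x = 0"
proof -
  have "unit_arc d 0 x x"
    unfolding unit_arc_def by (auto intro!: exI[of _ "\<lambda>_. x"] simp: ext_metric_refl[OF metric])
  then show ?thesis using P_le[OF P_arc] by force
qed

lemma d'_AC: "0 < a \<Longrightarrow> a \<le> b \<Longrightarrow> AC_curve 2 d' (edom F) a b (\<lambda>t. S t x)"
  using P_le[OF P_arc] by (intro AC_curve_transfer[OF metric S_AC]) auto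

lemma d'_finite_less:
  assumes "0 < s" "s \<le> t"
  shows "d' (S s x) (S t x) < \<infinity>"
proof -
  obtain g where "\<And>u v. s \<le> u \<Longrightarrow> u \<le> v \<Longrightarrow> v \<le> t \<Longrightarrow>
      d' (S u x) (S v x) \<le> ennreal (integral {u..v} g)"
    using AC_curve_control[OF d'_AC[OF assms]] by (metis one_le_numeral)
  then have "d' (S s x) (S t x) \<le> ennreal (integral {s..t} g)" using assms by simp
  then show ?thesis by (rule le_less_trans) simp
qed

lemma d'_finite:
  assumes "0 < s" "d' y (S s x) < \<infinity>" "0 < t"
  shows "d' (S t x) y < \<infinity>"
proof -
  have "d' (S t x) (S s x) < \<infinity>"
    using d'_finite_less[of s t x] d'_finite_less[of t s x] assms d'_sym[of "S s x" "S t x"]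
    by (cases "s \<le> t") auto
  then show ?thesis
    using d'_triangle[of "S t x" y "S s x"] assms(2) d'_sym[of y] by (auto intro: le_less_trans)
qed

text \<open>A discrete EVI with one time step \<open>h\<close>. The step is fixed while
  \<open>e\<close> tends to 0, which removes at once the local error of the flow and the surplus of
  the cost \<open>D + e\<close> over the distance; the factor of the squared distance is
  \<open>drift h 1\<close>.\<close>

lemma d'_estimate:
  assumes fin: "d' x y < \<infinity>" and y: "y \<in> edom F" and h: "0 < h" "\<bar>K\<bar> * h \<le> 1/2"
  shows "d' (S h x) y < \<infinity>"
    and "(enn2real (d' (S h x) y))\<^sup>2
      \<le> (enn2real (d' x y))\<^sup>2 * (1 + 4 * K\<^sup>2 * h\<^sup>2 - K * h) + 2 * h * (E y - E (S h x))"
proof -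
  define D where "D = enn2real (d' x y)"
  have D: "d' x y = ennreal D" "0 \<le> D" using fin by (simp_all add: D_def)
  define X where "X = 2 * h * (E y - E (S h x))"
  define B where "B = D\<^sup>2 * drift h 1 + X"
  define \<phi> where "\<phi> = (\<lambda>e. (1 + e) * (D + e)\<^sup>2 * drift h 1 + X)"
  have \<phi>_lim: "(\<phi> \<longlongrightarrow> B) (at_right 0)"
  proof -
    have "(\<phi> \<longlongrightarrow> (1 + 0) * (D + 0)\<^sup>2 * drift h 1 + X) (at_right 0)"
      unfolding \<phi>_def by (intro tendsto_intros)
    then show ?thesis by (simp add: B_def)
  qed
  have P_D: "P (D + e) x y" if "0 < e" for e
    using that D by (auto intro!: P_less simp: ennreal_less_iff)
  \<comment> \<open>Since \<open>\<phi> e\<close> tends to \<open>B\<close>, every \<open>c\<close>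
    with \<open>c\<^sup>2 > B\<close> satisfies the hypothesis of \<open>P_flow\<close> once
    \<open>e\<close> is small, and the sign statements for \<open>\<phi> e\<close> pass to the
    limit.\<close>
  have bound: "d' (S h x) y \<le> ennreal c \<and> 0 \<le> B" if c: "0 < c" "B < c\<^sup>2" for c
  proof -
    have "((\<lambda>e. \<phi> e - (1 - e) * c\<^sup>2) \<longlongrightarrow> B - (1 - 0) * c\<^sup>2) (at_right 0)"
      by (intro tendsto_intros \<phi>_lim)
    then have "eventually (\<lambda>e. \<phi> e - (1 - e) * c\<^sup>2 < 0) (at_right 0)"
      using c by (intro order_tendstoD(2)) auto
    moreover have "eventually (\<lambda>e::real. 0 < e \<and> e < 1) (at_right 0)"
      by (auto intro: eventually_at_rightI[of 0 1])
    ultimately have ev: "eventually (\<lambda>e. P c (S h x) y \<and> 0 \<le> \<phi> e) (at_right 0)"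
    proof eventually_elim
      case (elim e)
      then show ?case
        using P_flow[OF P_D y h, of e e c] c unfolding \<phi>_def X_def by auto
    qed
    then have "eventually (\<lambda>e. 0 \<le> \<phi> e) (at_right 0)" by (rule eventually_mono) simp
    then have "0 \<le> B" by (rule tendsto_lowerbound[OF \<phi>_lim]) simp
    moreover have "P c (S h x) y"
      using eventually_happens[OF ev] by simp
    ultimately show ?thesis using P_le by blast
  qed
  \<comment> \<open>One admissible cost is enough to know that \<open>B\<close> is nonnegative; only
    then can the optimal cost be approached through \<open>sqrt (B + e)\<close>.\<close>
  obtain c0 where c0: "0 < c0" "B < c0\<^sup>2"
  proof (rule that[of "\<bar>B\<bar> + 1"])
    have "B < (\<bar>B\<bar> + 1) * 1" by simp
    also have "\<dots> \<le> (\<bar>B\<bar> + 1) * (\<bar>B\<bar> + 1)" by (intro mult_left_mono) auto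
    finally show "B < (\<bar>B\<bar> + 1)\<^sup>2" by (simp add: power2_eq_square)
  qed simp
  show "d' (S h x) y < \<infinity>"
    using bound[OF c0] by (auto intro: le_less_trans)
  have "0 \<le> B" using bound[OF c0] by simp
  have "(enn2real (d' (S h x) y))\<^sup>2 \<le> B"
  proof (rule field_le_epsilon)
    fix e :: real assume "0 < e"
    define c where "c = sqrt (B + e)"
    have c: "0 < c" "c\<^sup>2 = B + e" using \<open>0 \<le> B\<close> \<open>0 < e\<close> by (simp_all add: c_def)
    then have "d' (S h x) y \<le> ennreal c" using bound[of c] \<open>0 < e\<close> by simp
    then have "enn2real (d' (S h x) y) \<le> c" using c by (intro enn2real_leI) auto
    then have "(enn2real (d' (S h x) y))\<^sup>2 \<le> c\<^sup>2" by (intro power_mono) auto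
    then show "(enn2real (d' (S h x) y))\<^sup>2 \<le> B + e" by (simp add: c)
  qed
  then show "(enn2real (d' (S h x) y))\<^sup>2
      \<le> (enn2real (d' x y))\<^sup>2 * (1 + 4 * K\<^sup>2 * h\<^sup>2 - K * h) + 2 * h * (E y - E (S h x))"
    by (simp add: B_def X_def D_def drift_1)
qed

section \<open>The EVI and the initial condition for the new distance\<close>

lemma eventually_small_time: "eventually (\<lambda>h. 0 < h \<and> \<bar>K\<bar> * h \<le> 1/2) (at_right 0)"
proof -
  have "((\<lambda>h. \<bar>K\<bar> * h) \<longlongrightarrow> \<bar>K\<bar> * 0) (at_right 0)" by (intro tendsto_intros)
  then have "eventually (\<lambda>h. \<bar>K\<bar> * h < 1/2) (at_right 0)" by (rule order_tendstoD(2)) simp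
  then show ?thesis
    using eventually_at_right_less[of 0] by eventually_elim simp
qed

lemma EVI_curve_d': "EVI_curve d' K F (\<lambda>t. S t x)"
  unfolding EVI_curve_def
proof (intro conjI allI impI ballI)
  fix a b :: real assume "0 < a \<and> a \<le> b"
  then show "AC_curve 2 d' (edom F) a b (\<lambda>t. S t x)" by (intro d'_AC) auto
next
  fix t :: real assume "0 < t"
  then show "F (S t x) \<le> Liminf (at t) (\<lambda>s. F (S s x))" by (rule S_lsc)
next
  fix y t assume y: "y \<in> edom F" and ex: "\<exists>t>0. d' y (S t x) < \<infinity>" and t: "0 < (t::real)"
  \<comment> \<open>By the semigroup law the curve is restarted at time \<open>t\<close>, so one
    step of length \<open>h\<close> from \<open>w\<close> gives the right difference
    quotient.\<close>
  define w where "w = S t x"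
  have w: "w \<in> edom F" using t by (simp add: w_def S_edom)
  have fin: "d' w y < \<infinity>" using ex t d'_finite by (auto simp: w_def)
  define D where "D = enn2real (d' w y)"
  define f where "f = (\<lambda>s. 1/2 * (enn2real (d' (S s x) y))\<^sup>2)"
  define C where "C = E y - E w - K/2 * D\<^sup>2"
  have ur: "upper_right_derivative f t \<le> ereal (C + e)" if "0 < e" for e
    unfolding upper_right_derivative_def
  proof (rule Limsup_bounded)
    \<comment> \<open>Half of \<open>e\<close> absorbs the second-order term
      \<open>4 * K\<^sup>2 * h\<^sup>2\<close> after halving and division by \<open>h\<close>; the
      other half absorbs a possible drop of the energy at time 0.\<close>
    have "((\<lambda>h. 2 * D\<^sup>2 * K\<^sup>2 * h) \<longlongrightarrow> 2 * D\<^sup>2 * K\<^sup>2 * 0) (at_right 0)" by (intro tendsto_intros)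
    then have "eventually (\<lambda>h. 2 * D\<^sup>2 * K\<^sup>2 * h < e / 2) (at_right 0)"
      by (rule order_tendstoD(2)) (use \<open>0 < e\<close> in simp)
    moreover have "eventually (\<lambda>h. E w - e / 2 < E (S h w)) (at_right 0)"
      by (rule S_lsc_0[OF w]) (use \<open>0 < e\<close> in simp)
    ultimately show "eventually (\<lambda>h. ereal ((f (t + h) - f t) / h) \<le> ereal (C + e)) (at_right 0)"
      using eventually_small_time
    proof eventually_elim
      case (elim h)
      then have h: "0 < h" "\<bar>K\<bar> * h \<le> 1/2" by auto
      have "S (t + h) x = S h w" using S_add[of h t x] h t by (simp add: w_def add.commute)
      then have "f (t + h) - f t = ((enn2real (d' (S h w) y))\<^sup>2 - D\<^sup>2) / 2"
        by (simp add: f_def D_def w_def)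
      also have "\<dots> \<le> (D\<^sup>2 * (1 + 4 * K\<^sup>2 * h\<^sup>2 - K * h) + 2 * h * (E y - E (S h w)) - D\<^sup>2) / 2"
        using d'_estimate(2)[OF fin y h] by (simp add: D_def)
      also have "\<dots> = h * (2 * D\<^sup>2 * K\<^sup>2 * h - K/2 * D\<^sup>2 + E y - E (S h w))"
        by (simp add: field_simps power2_eq_square)
      also have "\<dots> \<le> h * (C + e)"
        using elim h by (intro mult_left_mono) (auto simp: C_def)
      finally show ?case using h by (simp add: field_simps)
    qed
  qed
  have "upper_right_derivative f t \<le> ereal C"
  proof (rule ereal_le_epsilon2)
    fix e :: real assume "0 < e"
    from ur[OF this] show "upper_right_derivative f t \<le> ereal C + ereal e"
      by (simp only: plus_ereal.simps)
  qed
  then have "upper_right_derivative f t + ereal (K/2 * D\<^sup>2) \<le> ereal C + ereal (K/2 * D\<^sup>2)"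
    by (rule add_right_mono)
  also have "\<dots> = F y - F w" using y w by (simp add: C_def F_eq)
  finally show "upper_right_derivative (\<lambda>s. 1/2 * (enn2real (d' (S s x) y))\<^sup>2) t
      + ereal (K/2 * (enn2real (d' (S t x) y))\<^sup>2) \<le> F y - F (S t x)"
    by (simp add: f_def D_def w_def)
qed

text \<open>The discrete EVI is tested with the starting point itself. The energy drops by less than
  1 for small times, so the squared distance is at most \<open>2 * h\<close>.\<close>

lemma d'_start_edom:
  assumes w: "w \<in> edom F" and "0 < e"
  shows "eventually (\<lambda>t. d' (S t w) w \<le> ennreal e) (at_right 0)"
proof -
  have "((\<lambda>h. 2 * h) \<longlongrightarrow> 2 * (0::real)) (at_right 0)" by (intro tendsto_intros)
  then have "eventually (\<lambda>h. 2 * h < e\<^sup>2) (at_right 0)"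
    by (rule order_tendstoD(2)) (use \<open>0 < e\<close> in simp)
  moreover have "eventually (\<lambda>h. E w - 1 < E (S h w)) (at_right 0)"
    by (rule S_lsc_0[OF w]) simp
  ultimately show ?thesis
    using eventually_small_time
  proof eventually_elim
    case (elim h)
    then have h: "0 < h" "\<bar>K\<bar> * h \<le> 1/2" by auto
    have fin: "d' w w < \<infinity>" by (simp add: d'_refl)
    have "(enn2real (d' (S h w) w))\<^sup>2 \<le> 2 * h * (E w - E (S h w))"
      using d'_estimate(2)[OF fin w h] by (simp add: d'_refl)
    also have "\<dots> \<le> 2 * h * 1" using elim h by (intro mult_left_mono) auto
    also have "\<dots> \<le> e\<^sup>2" using elim by simp
    finally have "enn2real (d' (S h w) w) \<le> e"
      by (rule power2_le_imp_le) (use \<open>0 < e\<close> in simp)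
    then show ?case
      using d'_estimate(1)[OF fin w h]
      by (metis ennreal_enn2real ennreal_leI infinity_ennreal_def)
  qed
qed

text \<open>Continuity at time 0 passes from points of finite energy to their limits by contraction.
  The limits must be taken with respect to \<open>d'\<close>, which is why the new flow lives on
  this closure.\<close>

lemma d'_start:
  assumes x: "x \<in> ext_closure d' (edom F)" and "0 < e"
  shows "eventually (\<lambda>t. d' (S t x) x \<le> ennreal e) (at_right 0)"
proof -
  \<comment> \<open>Four contributions: the contraction factor is below 2, which gives
    \<open>2 * b\<close>, and the start at \<open>w\<close> and the return to \<open>x\<close> cost
    \<open>b\<close> each.\<close>
  define b where "b = e / 4"
  have "0 < b" using \<open>0 < e\<close> by (simp add: b_def)
  then have "0 < ennreal b" by simp
  then obtain w where w: "w \<in> edom F" "d' x w < ennreal b"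
    using x unfolding ext_closure_def by blast
  have "((\<lambda>t. exp (- K * t)) \<longlongrightarrow> exp (- K * 0)) (at_right 0)" by (intro tendsto_intros)
  then have "eventually (\<lambda>t. exp (- K * t) < 2) (at_right 0)" by (rule order_tendstoD(2)) simp
  then show ?thesis
    using d'_start_edom[OF w(1) \<open>0 < b\<close>] eventually_at_right_less[of 0]
  proof eventually_elim
    case (elim t)
    have "d' (S t x) (S t w) \<le> ennreal (exp (- K * t)) * d' x w"
      using elim by (intro d'_contraction) simp
    also have "\<dots> \<le> ennreal 2 * ennreal b"
      using elim w by (intro mult_mono ennreal_leI) auto
    also have "\<dots> = ennreal (2 * b)" using \<open>0 < b\<close> by (simp add: ennreal_mult)
    finally have 1: "d' (S t x) (S t w) \<le> ennreal (2 * b)" .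
    have "d' (S t x) x \<le> d' (S t x) (S t w) + (d' (S t w) w + d' w x)"
      by (meson add_left_mono d'_triangle order_trans)
    also have "\<dots> \<le> ennreal (2 * b) + (ennreal b + ennreal b)"
      using 1 elim w by (intro add_mono) (auto simp: d'_sym[of w])
    also have "\<dots> = ennreal e" using \<open>0 < b\<close> by (simp add: b_def flip: ennreal_plus)
    finally show ?case .
  qed
qed

text \<open>The energy clause does not involve the distance. Convergence of the distances follows
  from \<open>d'_start\<close> and the triangle inequality; an infinite distance stays infinite,
  since \<open>S t x\<close> is at finite distance from \<open>x\<close> for small times.\<close>

lemma starts_from_d':
  assumes x: "x \<in> ext_closure d' (edom F)"
  shows "starts_from d' F (\<lambda>t. S t x) x"
  unfolding starts_from_def
proof (intro conjI ballI)
  show "F x \<le> Liminf (at_right 0) (\<lambda>t. F (S t x))"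
    using S_starts[of x] by (simp add: starts_from_def)
  fix y
  show "((\<lambda>t. d' (S t x) y) \<longlongrightarrow> d' x y) (at_right 0)"
  proof (cases "d' x y = \<infinity>")
    case True
    have "eventually (\<lambda>t. d' (S t x) y = \<infinity>) (at_right 0)"
      using d'_start[OF x, of 1]
    proof (rule eventually_mono)
      fix t assume "d' (S t x) x \<le> ennreal 1"
      then have "d' x (S t x) \<noteq> top" by (auto simp: d'_sym[of x] top_unique)
      moreover have "top \<le> d' x (S t x) + d' (S t x) y"
        using d'_triangle[of x y "S t x"] True by simp
      ultimately show "d' (S t x) y = \<infinity>" by (simp add: top_unique)
    qed simp
    then show ?thesis using True by (simp add: tendsto_eventually)
  next
    case False
    then have fin: "d' x y < \<infinity>" by (simp add: less_top)
    have ev: "eventually (\<lambda>t. d' (S t x) y < \<infinity> \<and>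
        \<bar>enn2real (d' (S t x) y) - enn2real (d' x y)\<bar> \<le> e) (at_right 0)" if "0 < e" for e
      using d'_start[OF x that]
    proof (rule eventually_mono)
      fix t assume "d' (S t x) x \<le> ennreal e"
      then show "d' (S t x) y < \<infinity> \<and> \<bar>enn2real (d' (S t x) y) - enn2real (d' x y)\<bar> \<le> e"
        using enn2real_dist_diff_le[of d', OF d'_sym d'_triangle _ _ fin] that by simp
    qed
    have "((\<lambda>t. enn2real (d' (S t x) y)) \<longlongrightarrow> enn2real (d' x y)) (at_right 0)"
    proof (rule tendstoI)
      fix e :: real assume "0 < e"
      then have "0 < e / 2" by simp
      from ev[OF this] show "eventually (\<lambda>t. dist (enn2real (d' (S t x) y)) (enn2real (d' x y)) < e) (at_right 0)"
        by (rule eventually_mono) (use \<open>0 < e\<close> in \<open>auto simp: dist_real_def\<close>)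
    qed
    then have "((\<lambda>t. ennreal (enn2real (d' (S t x) y))) \<longlongrightarrow> ennreal (enn2real (d' x y))) (at_right 0)"
      by (rule tendsto_ennrealI)
    moreover have "eventually (\<lambda>t. ennreal (enn2real (d' (S t x) y)) = d' (S t x) y) (at_right 0)"
      using ev[OF zero_less_one] by (rule eventually_mono) auto
    ultimately show ?thesis
      using fin by (simp add: tendsto_cong)
  qed
qed

text \<open>Positive times lead into \<open>edom F\<close>, so the closure is invariant. The closure
  supplies the finite-distance and starting clauses; the EVI and the contraction are available from
  every starting point.\<close>

lemma EVI_flow_d':
  "EVI_flow d' K F (ext_closure d' (edom F)) S \<and> (\<forall>x. EVI_curve d' K F (\<lambda>t. S t x)) \<and>
   (\<forall>x y. \<forall>t\<ge>0. d' (S t x) (S t y) \<le> ennreal (exp (- K * t)) * d' x y)"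
proof -
  have dom: "x \<in> ext_closure d' (edom F)" if "x \<in> edom F" for x
    using that unfolding ext_closure_def by (auto intro!: bexI[of _ x] simp: d'_refl)
  have "S t x \<in> ext_closure d' (edom F)" if "x \<in> ext_closure d' (edom F)" "0 \<le> t" for x t
    using that dom S_edom[of t x] by (cases "t = 0") auto
  moreover have "\<exists>y\<in>edom F. d' x y < \<infinity>" if x: "x \<in> ext_closure d' (edom F)" for x
    using x unfolding ext_closure_def by (auto dest: spec[of _ 1] intro: less_trans)
  ultimately show ?thesis
    unfolding EVI_flow_def
    using S_add d'_contraction EVI_curve_d' starts_from_d' by simp
qed

end

end

theorem theorem3p5:
  fixes d :: "'a \<Rightarrow> 'a \<Rightarrow> ennreal" and K :: real
    and F :: "'a \<Rightarrow> ereal" and S :: "real \<Rightarrow> 'a \<Rightarrow> 'a"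
  assumes "ext_metric d"
    and "\<And>x. F x \<noteq> -\<infinity>"
    and "edom F \<noteq> {}"
    and "EVI_flow d K F UNIV S"
  shows "\<forall>d'\<in>{length_dist d, AC_length_dist d}.
           EVI_flow d' K F (ext_closure d' (edom F)) S \<and>
           (\<forall>x. EVI_curve d' K F (\<lambda>t. S t x)) \<and>
           (\<forall>x y. \<forall>t\<ge>0. d' (S t x) (S t y) \<le> ennreal (exp (- K * t)) * d' x y)"
proof -
  interpret EVI_flow_on_space d K F S
    by standard (use assms in auto)
  have "EVI_flow (length_dist d) K F (ext_closure (length_dist d) (edom F)) S \<and>
      (\<forall>x. EVI_curve (length_dist d) K F (\<lambda>t. S t x)) \<and>
      (\<forall>x y. \<forall>t\<ge>0. length_dist d (S t x) (S t y) \<le> ennreal (exp (- K * t)) * length_dist d x y)"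
  proof (rule EVI_flow_d'[of "length_dist d" "fine_chains d"])
    show "fine_chains d c (S h x) y \<and> 0 \<le> (1 + e) * L\<^sup>2 * drift h 1 + 2 * h * (E y - E (S h x))"
      if "fine_chains d L x y" "y \<in> edom F" "0 < h" "\<bar>K\<bar> * h \<le> 1/2" "0 < e" "e < 1" "0 < c"
        "(1 + e) * L\<^sup>2 * drift h 1 + 2 * h * (E y - E (S h x)) \<le> (1 - e) * c\<^sup>2" for L x y h e c
      by (intro conjI fine_chains_flow[OF that])
    show "fine_chains d (exp (- K * t) * c) (S t y) (S t z)" if "0 \<le> t" "fine_chains d c y z" for t c y z
      using that by (intro fine_chains_lipschitz_image S_contraction) auto
  qed (fact fine_chains_of_length_dist_less[OF metric] length_dist_le[OF metric]
      fine_chains_sym[OF metric] fine_chains_trans fine_chains_of_unit_arc)+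
  moreover have "EVI_flow (AC_length_dist d) K F (ext_closure (AC_length_dist d) (edom F)) S \<and>
      (\<forall>x. EVI_curve (AC_length_dist d) K F (\<lambda>t. S t x)) \<and>
      (\<forall>x y. \<forall>t\<ge>0. AC_length_dist d (S t x) (S t y) \<le> ennreal (exp (- K * t)) * AC_length_dist d x y)"
  proof (rule EVI_flow_d'[of "AC_length_dist d" "unit_arc d"])
    show "unit_arc d c (S h x) y \<and> 0 \<le> (1 + e) * L\<^sup>2 * drift h 1 + 2 * h * (E y - E (S h x))"
      if "unit_arc d L x y" "y \<in> edom F" "0 < h" "\<bar>K\<bar> * h \<le> 1/2" "0 < e" "e < 1" "0 < c"
        "(1 + e) * L\<^sup>2 * drift h 1 + 2 * h * (E y - E (S h x)) \<le> (1 - e) * c\<^sup>2" for L x y h e c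
      by (intro conjI unit_arc_flow[OF that])
    show "unit_arc d (exp (- K * t) * c) (S t y) (S t z)" if "0 \<le> t" "unit_arc d c y z" for t c y z
      using that by (intro unit_arc_lipschitz_image[OF metric] S_contraction) auto
  qed (fact unit_arc_of_AC_length_dist_less[OF metric] AC_length_dist_le[OF metric]
      unit_arc_sym[OF metric] unit_arc_trans[OF metric])+
  ultimately show ?thesis by blast
qed

end
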